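(* Let $T_1,\dots,T_m:\mathbb R^d\to\mathbb R^d$ be continuous firmly quasi-nonexpansive operators with $F:=\bigcap_{i=1}^m\operatorname{Fix}T_i\ne\emptyset$, let $x^0\notin F$, and consider the randomized Krasnosel'skiĭ–Mann method $$x^{k+1}=x^k+\beta_k(T_{i_k}(x^k)-x^k),\qquad k\ge0,$$ where $0<\beta_k\le\bar\beta<2$ for all $k$, $\sum_{k=0}^\infty\beta_k=+\infty$, and, for some $\rho>0$, $\mathbb P(i_k=i\mid\mathcal F_k)\ge\rho$ for all $i\in[m]$, $k\ge0$. Let $p^0$ be the projection of $x^0$ onto $F$, $h_0:=\operatorname{dist}^2(x^0,F)$, $S:=\overline{\mathbb B}(p^0,\operatorname{dist}(x^0,F))$, and let $\phi_S$ be a GUEB modulus on $S$ for the pair $h(x)=\operatorname{dist}^2(x,F)$, $g(x)=\max_{i\in[m]}\|T_i(x)-x\|^2$. Put $A_k:=\sum_{i=0}^{k-1}\beta_i$ and $\mathfrak h:=\frac{1-\log2}2$. Then for all $k\ge1$ $$\mathbb E[\operatorname{dist}^2(x^k,F)]\le\exp\Big(-\mathfrak h\frac\rho{\bar\beta}A_k\Big)h_0+\Psi_S^{-1}\Big(\Psi_S(h_0)+\frac{(2-\bar\beta)\rho}2A_k\Big),$$ and there exists an almost surely finite random index $K_1$ such that, almost surely, $$\operatorname{dist}^2(x^k,F)\le\Psi_S^{-1}\Big(\frac{(2-\bar\beta)\rho}2A_k\Big)\qquad\forall k\ge K_1.$$ Moreover, there exists a random variable $x^*\in F$ such that $x^k\to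 x^*$ almost surely and in $L^1$, $$\mathbb E[\|x^k-x^*\|]\le2\sqrt{\mathbb E[\operatorname{dist}^2(x^k,F)]}\qquad\forall k\ge0,$$ and there exists an almost surely finite random index $K_2$ such that, almost surely, $$\|x^k-x^*\|\le2\sqrt{\Psi_S^{-1}\Big(\frac{(2-\bar\beta)\rho}2A_k\Big)}\qquad\forall k\ge K_2.$$
   Context: Setting. $(\Omega,\mathcal F,\{\mathcal F_k\}_{k\ge0},\mathbb P)$ is a filtered probability space, $x^0$ and $\{\beta_k\}$ are deterministic, and $i_k\in[m]=\{1,\dots,m\}$ is an $\mathcal F_{k+1}$-measurable random index. $\operatorname{Fix}T=\{x:T(x)=x\}$. $T:\mathbb R^d\to\mathbb R^d$ is firmly quasi-nonexpansive if $\|Tx-y\|^2+\|Tx-x\|^2\le\|x-y\|^2$ for all $y\in\operatorname{Fix}T$ and $x\in\mathbb R^d$ (then $F$ is closed and convex). $\overline{\mathbb B}(p,r)$ is the closed ball. GUEB modulus on $S$: a function $\phi_S:[0,\tau)\to\mathbb R_+$, $\tau\in(0,+\infty]$, with $\phi_S(h(x)-h^* )\le g(x)$ for all $x\in S$, where $h^*=\inf_Sh=0$; $\phi_S$ non-decreasing and strictly positive on $(0,\tau)$ with $\phi_S(0)=0$; and $0\le h(x)-h^*<\tau$ on $S$. (Such a modulus exists under the stated hypotheses.) Fix any $t_0\in(0,\tau)$; $\Psi_S(t):=\int_t^{t_0}\frac{ds}{\phi_S(s)}$, which is strictly decreasing with inverse $\Psi_S^{-1}$ (in this setting $1/\phi_S$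 is not integrable near $0$, so $\Psi_S(t)\to+\infty$ as $t\downarrow0$ and $\Psi_S^{-1}$ is defined on $(\lim_{t\uparrow\tau}\Psi_S(t),+\infty]$, with $\Psi_S^{-1}(+\infty)=0$). *)

theory Defs
  imports "HOL-Probability.Probability"
begin

definition Fix :: "('a \<Rightarrow> 'a) \<Rightarrow> 'a set" where
  "Fix T = {x. T x = x}"

definition firmly_quasi_nonexpansive :: "('a::real_normed_vector \<Rightarrow> 'a) \<Rightarrow> bool" where
  "firmly_quasi_nonexpansive T \<longleftrightarrow>
     (\<forall>x. \<forall>y\<in>Fix T. (norm (T x - y))\<^sup>2 + (norm (T x - x))\<^sup>2 \<le> (norm (x - y))\<^sup>2)"

text \<open>
  The modulus \<open>\<phi>\<close> is a function on the half-open interval \<open>[0, \<tau>)\<close>, where \<open>\<tau>\<close> may be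
  infinite. It is represented by a total function on the reals, of which only the values on this
  interval matter.
\<close>

definition gueb_dom :: "ereal \<Rightarrow> real set" where
  "gueb_dom \<tau> = {t. 0 \<le> t \<and> ereal t < \<tau>}"

definition gueb_modulus ::
    "'a set \<Rightarrow> ('a \<Rightarrow> real) \<Rightarrow> ('a \<Rightarrow> real) \<Rightarrow> ereal \<Rightarrow> (real \<Rightarrow> real) \<Rightarrow> bool" where
  "gueb_modulus S h g \<tau> \<phi> \<longleftrightarrow>
     0 < \<tau> \<and>
     mono_on (gueb_dom \<tau>) \<phi> \<and> \<phi> 0 = 0 \<and> (\<forall>t\<in>gueb_dom \<tau> - {0}. 0 < \<phi> t) \<and>
     (\<forall>x\<in>S. h x - (INF y\<in>S. h y) \<in> gueb_dom \<tau>) \<and>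
     (\<forall>x\<in>S. \<phi> (h x - (INF y\<in>S. h y)) \<le> g x)"

text \<open>
  The integral of \<open>1/\<phi>\<close> from \<open>t\<close> to \<open>t0\<close> is oriented, so that the value is negative for
  \<open>t > t0\<close>. The value at \<open>0\<close> is set to its limit \<open>\<infinity>\<close>, so that the inverse
  on \<open>[0, \<tau>)\<close> sends \<open>\<infinity>\<close> to \<open>0\<close>. The inverse is only meaningful on the image
  of \<open>[0, \<tau>)\<close>.
\<close>

definition gueb_Psi :: "(real \<Rightarrow> real) \<Rightarrow> real \<Rightarrow> real \<Rightarrow> ereal" where
  "gueb_Psi \<phi> t0 t = (if t = 0 then \<infinity> else ereal (LBINT s=ereal t..ereal t0. 1 / \<phi> s))"

definition gueb_Psi_inv :: "ereal \<Rightarrow> (real \<Rightarrow> real) \<Rightarrow> real \<Rightarrow> ereal \<Rightarrow> real" where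
  "gueb_Psi_inv \<tau> \<phi> t0 = the_inv_into (gueb_dom \<tau>) (gueb_Psi \<phi> t0)"

end

theory Submission
  imports Defs
begin

text \<open>
  Let \<open>Y k\<close> be the squared distance of the \<open>k\<close>-th iterate to \<open>F\<close> and \<open>E k\<close> the event that an index with
  the largest residual is drawn at step \<open>k\<close>. Fejer monotonicity gives
  \<open>Y (k + 1) \<le> Y k - \<beta> k (2 - \<beta>bar) \<phi> (Y k)\<close> on \<open>E k\<close>, so, \<open>\<phi>\<close> being non-decreasing, along every
  path \<open>\<Psi> (Y n)\<close> is at least \<open>\<Psi> h0 + (2 - \<beta>bar) R n\<close>, where \<open>R n\<close> is the sum of the \<open>\<beta> k\<close>, \<open>k < n\<close>,
  for which \<open>E k\<close> occurs. Since \<open>E k\<close> has conditional probability at least \<open>\<rho>\<close>, a Chernoff bound shows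
  that \<open>R n < \<rho> A n / 2\<close> has the stated exponentially small probability, and a Borel--Cantelli argument
  shows that almost surely \<open>R n\<close> eventually exceeds \<open>\<rho> A n / 2\<close> by any given constant. Finally, the
  residuals are at most the distance to \<open>F\<close>, hence \<open>\<phi> s \<le> s\<close> on \<open>(0, h0]\<close>, so \<open>\<Psi>\<close> is unbounded near \<open>0\<close>
  and its inverse is defined at all the values that occur.
\<close>

section \<open>Firmly quasi-nonexpansive operators and Fejer monotone sequences\<close>

text \<open>Expanding the square of \<open>T x - y = (T x - x) + (x - y)\<close> turns the defining
  inequality into a bound on the cross term.\<close>

lemma firmly_quasi_nonexpansive_inner_le:
  fixes T :: "'a::real_inner \<Rightarrow> 'a"
  assumes "firmly_quasi_nonexpansive T" "y \<in> Fix T"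
  shows "(T x - x) \<bullet> (x - y) \<le> - (norm (T x - x))\<^sup>2"
proof -
  have "(norm (T x - y))\<^sup>2 = (norm ((T x - x) + (x - y)))\<^sup>2"
    by simp
  also have "\<dots> = (norm (T x - x))\<^sup>2 + 2 * ((T x - x) \<bullet> (x - y)) + (norm (x - y))\<^sup>2"
    unfolding power2_norm_eq_inner
    by (simp only: inner_add_left[of "T x - x" "x - y"] inner_add_right[of _ "T x - x" "x - y"]
        inner_commute[of "x - y" "T x - x"])
  finally have "(norm (T x - y))\<^sup>2 = (norm (T x - x))\<^sup>2 + 2 * ((T x - x) \<bullet> (x - y)) + (norm (x - y))\<^sup>2" .
  moreover have "(norm (T x - y))\<^sup>2 + (norm (T x - x))\<^sup>2 \<le> (norm (x - y))\<^sup>2"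
    using assms unfolding firmly_quasi_nonexpansive_def by blast
  ultimately show ?thesis
    by linarith
qed

text \<open>The halfspace indexed by \<open>x = y\<close> already forces \<open>T y - y\<close> to
  vanish. An intersection of closed halfspaces is closed and convex.\<close>

lemma Fix_eq_halfspaces:
  fixes T :: "'a::real_inner \<Rightarrow> 'a"
  assumes "firmly_quasi_nonexpansive T"
  shows "Fix T = (\<Inter>x. {y. (T x - x) \<bullet> y \<ge> (T x - x) \<bullet> x + (norm (T x - x))\<^sup>2})"
proof (intro equalityI subsetI)
  fix y assume "y \<in> Fix T"
  then show "y \<in> (\<Inter>x. {y. (T x - x) \<bullet> y \<ge> (T x - x) \<bullet> x + (norm (T x - x))\<^sup>2})"
    using firmly_quasi_nonexpansive_inner_le[OF assms, of y]
    by (simp add: inner_diff_right le_diff_eq diff_le_eq add.commute)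
next
  fix y assume "y \<in> (\<Inter>x. {y. (T x - x) \<bullet> y \<ge> (T x - x) \<bullet> x + (norm (T x - x))\<^sup>2})"
  then have "(T y - y) \<bullet> y \<ge> (T y - y) \<bullet> y + (norm (T y - y))\<^sup>2"
    by blast
  then show "y \<in> Fix T"
    by (simp add: Fix_def)
qed

lemma closed_Fix:
  fixes T :: "'a::real_inner \<Rightarrow> 'a"
  assumes "firmly_quasi_nonexpansive T"
  shows "closed (Fix T)"
  unfolding Fix_eq_halfspaces[OF assms] by (intro closed_INT ballI closed_halfspace_ge)

lemma convex_Fix:
  fixes T :: "'a::real_inner \<Rightarrow> 'a"
  assumes "firmly_quasi_nonexpansive T"
  shows "convex (Fix T)"
  unfolding Fix_eq_halfspaces[OF assms] by (intro convex_INT convex_halfspace_ge)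

text \<open>The cross term contributes at most \<open>- 2 * b\<close> and the square
  \<open>b * b\<close> times the squared residual, whence the factor
  \<open>b * (2 - b)\<close>.\<close>

lemma relaxed_step_norm_le:
  fixes T :: "'a::real_inner \<Rightarrow> 'a"
  assumes "firmly_quasi_nonexpansive T" "y \<in> Fix T" "0 \<le> b"
  shows "(norm (x + b *\<^sub>R (T x - x) - y))\<^sup>2 \<le> (norm (x - y))\<^sup>2 - b * (2 - b) * (norm (T x - x))\<^sup>2"
proof -
  have "(norm (x + b *\<^sub>R (T x - x) - y))\<^sup>2 = (norm ((x - y) + b *\<^sub>R (T x - x)))\<^sup>2"
    by (simp add: algebra_simps)
  also have "\<dots> = (norm (x - y))\<^sup>2 + 2 * b * ((T x - x) \<bullet> (x - y)) + b\<^sup>2 * (norm (T x - x))\<^sup>2"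
    unfolding power2_norm_eq_inner
    by (simp add: inner_add_left inner_add_right inner_commute power2_eq_square algebra_simps)
  also have "\<dots> \<le> (norm (x - y))\<^sup>2 + 2 * b * - (norm (T x - x))\<^sup>2 + b\<^sup>2 * (norm (T x - x))\<^sup>2"
    using firmly_quasi_nonexpansive_inner_le[OF assms(1,2), of x] assms(3)
    by (intro add_mono mult_left_mono) auto
  also have "\<dots> = (norm (x - y))\<^sup>2 - b * (2 - b) * (norm (T x - x))\<^sup>2"
    by (simp add: algebra_simps power2_eq_square)
  finally show ?thesis .
qed

text \<open>Cauchy--Schwarz in the cross term bound gives the estimate for each point of
  \<open>F\<close>. This is what later forces \<open>\<phi> s \<le> s\<close>.\<close>

lemma residual_le_infdist:
  fixes T :: "'a::real_inner \<Rightarrow> 'a"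
  assumes "firmly_quasi_nonexpansive T" "F \<subseteq> Fix T" "F \<noteq> {}"
  shows "norm (T x - x) \<le> infdist x F"
proof -
  have "norm (T x - x) \<le> dist x y" if "y \<in> F" for y
  proof -
    have "(norm (T x - x))\<^sup>2 \<le> - ((T x - x) \<bullet> (x - y))"
      using firmly_quasi_nonexpansive_inner_le[OF assms(1), of y x] that assms(2) by auto
    also have "\<dots> \<le> norm (T x - x) * norm (x - y)"
      using norm_cauchy_schwarz[of "x - T x" "x - y"]
      by (metis inner_minus_left minus_diff_eq norm_minus_commute)
    finally have "norm (T x - x) * norm (T x - x) \<le> norm (T x - x) * norm (x - y)"
      by (simp add: power2_eq_square)
    then show ?thesis
      by (cases "norm (T x - x) = 0") (auto simp: dist_norm)
  qed
  then show ?thesis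
    unfolding infdist_notempty[OF assms(3)] by (intro cINF_greatest assms(3))
qed

lemma infdist_eq_dist_closest_point:
  fixes F :: "'a::euclidean_space set"
  assumes "closed F" "F \<noteq> {}"
  shows "infdist x F = dist x (closest_point F x)"
  using closest_point_in_set[OF assms] closest_point_le[OF assms(1)] assms(2)
  by (intro antisym infdist_le) (auto simp: infdist_notempty intro!: cINF_greatest)

text \<open>The vector \<open>x - p\<close> is normal to \<open>F\<close> at \<open>p\<close>, so
  \<open>p\<close> remains a nearest point along the whole ray from \<open>p\<close> through
  \<open>x\<close>.\<close>

lemma infdist_closest_point_segment:
  fixes F :: "'a::euclidean_space set" and x :: 'a
  assumes "closed F" "convex F" "F \<noteq> {}" "0 \<le> s"
  defines "p \<equiv> closest_point F x"
  shows "infdist (p + s *\<^sub>R (x - p)) F = s * infdist x F"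
proof -
  let ?z = "p + s *\<^sub>R (x - p)"
  have p: "p \<in> F"
    unfolding p_def by (rule closest_point_in_set[OF assms(1,3)])
  have "dist ?z p \<le> dist ?z y" if y: "y \<in> F" for y
  proof -
    have *: "(x - p) \<bullet> (y - p) \<le> 0"
      unfolding p_def by (rule closest_point_dot[OF assms(2,1) y])
    then have "s *\<^sub>R (x - p) \<bullet> (y - p) \<le> 0"
      using assms(4) by (simp add: mult_nonneg_nonpos)
    then have "(norm (s *\<^sub>R (x - p)))\<^sup>2 \<le> (norm (s *\<^sub>R (x - p) - (y - p)))\<^sup>2"
      using zero_le_power2[of "norm (y - p)"] dot_norm_neg[of "s *\<^sub>R (x - p)" "y - p"] by argo
    then have "norm (s *\<^sub>R (x - p)) \<le> norm (s *\<^sub>R (x - p) - (y - p))"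
      by (rule power2_le_imp_le) simp
    moreover have "s *\<^sub>R (x - p) - (y - p) = ?z - y"
      by (simp add: algebra_simps)
    ultimately show ?thesis
      by (simp add: dist_norm)
  qed
  then have "infdist ?z F = dist ?z p"
    using p assms(3) by (intro antisym infdist_le) (auto simp: infdist_notempty intro!: cINF_greatest)
  also have "\<dots> = s * infdist x F"
    using assms(4) by (simp add: infdist_eq_dist_closest_point[OF assms(1,3)] p_def dist_norm)
  finally show ?thesis .
qed

text \<open>
  From \<open>X n\<close> on, the sequence stays in the ball around the projection of \<open>X n\<close> onto \<open>F\<close> that has
  \<open>X n\<close> on its boundary.
\<close>

lemma fejer_convergent:
  fixes X :: "nat \<Rightarrow> 'a::euclidean_space"
  assumes F: "closed F" "F \<noteq> {}"
    and fejer: "\<And>n y. y \<in> F \<Longrightarrow> dist (X (Suc n)) y \<le> dist (X n) y"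
    and lim: "(\<lambda>n. infdist (X n) F) \<longlonglongrightarrow> 0"
  shows "\<exists>l\<in>F. X \<longlonglongrightarrow> l \<and> (\<forall>n. dist (X n) l \<le> 2 * infdist (X n) F)"
proof -
  have close: "dist (X n) (X k) \<le> 2 * infdist (X n) F" if "n \<le> k" for n k
  proof -
    define q where "q = closest_point F (X n)"
    have "q \<in> F"
      unfolding q_def by (rule closest_point_in_set[OF F])
    then have "dist (X k) q \<le> dist (X n) q"
      by (intro lift_Suc_antimono_le[of "\<lambda>n. dist (X n) q", OF fejer that])
    moreover have "dist (X n) q = infdist (X n) F"
      by (simp add: infdist_eq_dist_closest_point[OF F] q_def)
    ultimately show ?thesis
      using dist_triangle2[of "X n" "X k" q] by simp
  qed
  have "Cauchy X"
  proof (rule metric_CauchyI)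
    fix e :: real assume "0 < e"
    then obtain N where N: "\<And>n. n \<ge> N \<Longrightarrow> infdist (X n) F < e / 4"
      using LIMSEQ_D[OF lim, of "e / 4"] by (auto simp: infdist_nonneg)
    \<comment> \<open>Both points are within \<open>2 * infdist (X N) F < e / 2\<close> of
      \<open>X N\<close>.\<close>
    have "dist (X n) (X k) < e" if "n \<ge> N" "k \<ge> N" for n k
      using close[of N n] close[of N k] N[of N] that dist_triangle3[of "X n" "X k" "X N"] by simp
    then show "\<exists>N. \<forall>n\<ge>N. \<forall>k\<ge>N. dist (X n) (X k) < e"
      by blast
  qed
  then obtain l where l: "X \<longlonglongrightarrow> l"
    using Cauchy_convergent convergent_def by blast
  have "infdist l F = 0"
    using LIMSEQ_unique[OF tendsto_infdist[OF l] lim] .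
  then have "l \<in> F"
    by (simp add: in_closed_iff_infdist_zero[OF F])
  moreover have "dist (X n) l \<le> 2 * infdist (X n) F" for n
    by (rule LIMSEQ_le_const2[OF tendsto_dist[OF tendsto_const l]]) (use close in blast)
  ultimately show ?thesis
    using l by blast
qed

section \<open>The rate function and its inverse\<close>

text \<open>Separates the calculus of \<open>gueb_Psi\<close> from the operators: only the shape of
  \<phi> on its interval enters, and its value at \<open>0\<close> is an explicit assumption where
  it matters.\<close>

locale gueb_rate =
  fixes \<tau> :: ereal and \<phi> :: "real \<Rightarrow> real" and t0 :: real
  assumes mono: "mono_on (gueb_dom \<tau>) \<phi>"
    and pos: "t \<in> gueb_dom \<tau> \<Longrightarrow> 0 < t \<Longrightarrow> 0 < \<phi> t"
    and t0: "0 < t0" "t0 \<in> gueb_dom \<tau>"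
begin

lemma dom_downward: "b \<in> gueb_dom \<tau> \<Longrightarrow> 0 \<le> a \<Longrightarrow> a \<le> b \<Longrightarrow> a \<in> gueb_dom \<tau>"
  unfolding gueb_dom_def by (auto intro: le_less_trans[of "ereal a" "ereal b"])

text \<open>A monotone function is Borel, and away from \<open>0\<close> its reciprocal is bounded
  by the value at the left endpoint.\<close>

lemma set_integrable_inverse:
  assumes "0 < a" "b \<in> gueb_dom \<tau>"
  shows "set_integrable lborel {a..b} (\<lambda>s. 1 / \<phi> s)"
proof (cases "a \<le> b")
  case True
  have sub: "{a..b} \<subseteq> gueb_dom \<tau>"
    using assms dom_downward by auto
  have "\<phi> \<in> borel_measurable (restrict_space borel {a..b})"
    by (intro borel_measurable_mono_on_fnc monotone_on_subset[OF mono sub])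
  then have meas: "(\<lambda>s. 1 / \<phi> s) \<in> borel_measurable (restrict_space lborel {a..b})"
    by (subst measurable_cong_sets[OF sets_restrict_space_cong[OF sets_lborel] refl]) measurable
  have bound: "\<bar>1 / \<phi> s\<bar> \<le> 1 / \<phi> a" if "s \<in> {a..b}" for s
  proof -
    have "0 < \<phi> a" "\<phi> a \<le> \<phi> s"
      using that assms(1) subsetD[OF sub, of a] subsetD[OF sub, of s] pos[of a] mono_onD[OF mono, of a s]
      by auto
    then show ?thesis
      by (simp add: frac_le)
  qed
  have const: "set_integrable lborel {a..b} (\<lambda>_. 1 / \<phi> a)"
    by (rule borel_integrable_atLeastAtMost') auto
  show ?thesis
    by (rule set_integrable_bound[OF const])
      (use meas order_trans[OF bound abs_ge_self] in
        \<open>auto simp: set_borel_measurable_def borel_measurable_restrict_space_iff intro!: AE_I2\<close>)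
qed (simp add: set_integrable_def)

abbreviation I :: "real \<Rightarrow> real \<Rightarrow> real" where
  "I a b \<equiv> (LBINT s=ereal a..ereal b. 1 / \<phi> s)"

lemma gueb_Psi_pos [simp]: "0 < t \<Longrightarrow> gueb_Psi \<phi> t0 t = ereal (I t t0)"
  by (simp add: gueb_Psi_def)

lemma gueb_Psi_0 [simp]: "gueb_Psi \<phi> t0 0 = \<infinity>"
  by (simp add: gueb_Psi_def)

text \<open>The integral is oriented, so the three points may come in any order; integrability is
  required on the interval they span.\<close>

lemma I_split:
  assumes "0 < a" "0 < b" "0 < c" "a \<in> gueb_dom \<tau>" "b \<in> gueb_dom \<tau>" "c \<in> gueb_dom \<tau>"
  shows "I a b + I b c = I a c"
proof (rule interval_integral_sum)
  define l u where "l = min a (min b c)" and "u = max a (max b c)"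
  have lu: "0 < l" "l \<le> u" "u \<in> gueb_dom \<tau>"
    using assms by (auto simp: l_def u_def max_def)
  have "set_integrable lborel {l<..<u} (\<lambda>s. 1 / \<phi> s)"
    by (rule set_integrable_subset[OF set_integrable_inverse[OF lu(1,3)]]) auto
  then have "interval_lebesgue_integrable lborel (ereal l) (ereal u) (\<lambda>s. 1 / \<phi> s)"
    using lu(2) by (simp add: interval_lebesgue_integrable_def)
  then show "interval_lebesgue_integrable lborel (min (ereal a) (min (ereal b) (ereal c)))
      (max (ereal a) (max (ereal b) (ereal c))) (\<lambda>s. 1 / \<phi> s)"
    by (simp only: l_def u_def ereal_min ereal_max)
qed

text \<open>The integrand is non-increasing, so its mean lies between its values at the
  endpoints.\<close>

lemma I_bounds:
  assumes "0 < a" "a \<le> b" "b \<in> gueb_dom \<tau>"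
  shows "(b - a) / \<phi> b \<le> I a b" "I a b \<le> (b - a) / \<phi> a"
proof -
  have eq: "I a b = (LBINT s:{a..b}. 1 / \<phi> s)"
    using interval_integral_Icc[OF assms(2)] .
  have a: "a \<in> gueb_dom \<tau>"
    using assms dom_downward by simp
  have const: "(LBINT s:{a..b}. c) = (b - a) * c" for c :: real
    using assms(2) by (simp add: set_lebesgue_integral_def)
  have const_int: "set_integrable lborel {a..b} (\<lambda>_. c)" for c :: real
    by (rule borel_integrable_atLeastAtMost') auto
  have le: "1 / \<phi> b \<le> 1 / \<phi> s" "1 / \<phi> s \<le> 1 / \<phi> a" if "s \<in> {a..b}" for s
  proof -
    have s: "s \<in> gueb_dom \<tau>" "0 < s"
      using that assms dom_downward by auto
    show "1 / \<phi> b \<le> 1 / \<phi> s" "1 / \<phi> s \<le> 1 / \<phi> a"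
      using that mono_onD[OF mono s(1) assms(3)] mono_onD[OF mono a s(1)] pos[OF s] pos[OF a assms(1)]
      by (auto intro!: divide_left_mono mult_pos_pos)
  qed
  have "(LBINT s:{a..b}. 1 / \<phi> b) \<le> (LBINT s:{a..b}. 1 / \<phi> s)"
    by (intro set_integral_mono const_int set_integrable_inverse le assms)
  then show "(b - a) / \<phi> b \<le> I a b"
    by (simp add: eq const)
  have "(LBINT s:{a..b}. 1 / \<phi> s) \<le> (LBINT s:{a..b}. 1 / \<phi> a)"
    by (intro set_integral_mono const_int set_integrable_inverse le assms)
  then show "I a b \<le> (b - a) / \<phi> a"
    by (simp add: eq const)
qed

lemma I_strict_antimono:
  assumes "0 < a" "a < b" "b \<in> gueb_dom \<tau>"
  shows "I b t0 < I a t0"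
proof -
  have "a \<in> gueb_dom \<tau>"
    using assms dom_downward by simp
  then have "I a b + I b t0 = I a t0"
    using assms t0 by (intro I_split) auto
  moreover have "0 < (b - a) / \<phi> b"
    using assms pos[of b] by simp
  ultimately show ?thesis
    using I_bounds(1)[of a b] assms by simp
qed

lemma gueb_Psi_strict_antimono:
  assumes "0 \<le> a" "a < b" "b \<in> gueb_dom \<tau>"
  shows "gueb_Psi \<phi> t0 b < gueb_Psi \<phi> t0 a"
  using assms I_strict_antimono[of a b] by (cases "a = 0") auto

lemma gueb_Psi_inj_on: "inj_on (gueb_Psi \<phi> t0) (gueb_dom \<tau>)"
  by (rule linorder_inj_onI') (metis gueb_Psi_strict_antimono gueb_dom_def less_irrefl mem_Collect_eq)

lemma gueb_Psi_le_imp_ge: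
  assumes "a \<in> gueb_dom \<tau>" "b \<in> gueb_dom \<tau>" "gueb_Psi \<phi> t0 a \<le> gueb_Psi \<phi> t0 b"
  shows "b \<le> a"
  by (rule ccontr) (use assms gueb_Psi_strict_antimono[of a b] in \<open>auto simp: gueb_dom_def\<close>)

text \<open>One step of a discrete analogue of the differential equation
  \<open>y' = - \<phi> y\<close>: the interval from \<open>a\<close> to \<open>b\<close> has length
  at least \<open>w * \<phi> b\<close>, and the integrand on it is at least
  \<open>1 / \<phi> b\<close>. At \<open>a = 0\<close> the right-hand side is infinite.\<close>

lemma gueb_Psi_decrement:
  assumes "b \<in> gueb_dom \<tau>" "0 \<le> a" "0 \<le> w" "a \<le> b - w * \<phi> b" "\<phi> 0 = 0"
  shows "gueb_Psi \<phi> t0 b + ereal w \<le> gueb_Psi \<phi> t0 a"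
proof (cases "a = 0")
  case False
  have "0 \<le> \<phi> b"
    using pos[OF assms(1)] assms(1,5) by (cases "b = 0") (auto simp: gueb_dom_def)
  then have ab: "a \<le> b"
    using assms(4) mult_nonneg_nonneg[OF assms(3), of "\<phi> b"] by linarith
  then have a: "0 < a" "0 < b" "a \<in> gueb_dom \<tau>"
    using False assms(1,2) dom_downward[of b a] by auto
  have "w \<le> (b - a) / \<phi> b"
    using assms(4) pos[OF assms(1) a(2)] by (simp add: field_simps)
  also have "\<dots> \<le> I a b"
    using I_bounds(1)[OF a(1) ab assms(1)] .
  finally show ?thesis
    using I_split[of a b t0] a assms(1) t0 by simp
qed simp

text \<open>
  The bound \<open>\<phi> s \<le> s\<close> makes \<open>1/\<phi>\<close> non-integrable at \<open>0\<close>, so that all large values are attained.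
  It is applied on each piece of a geometric subdivision of the interval below \<open>b\<close>.
\<close>

lemma I_geometric_lower_bound:
  assumes "0 < b" "b \<in> gueb_dom \<tau>" "\<And>s. 0 < s \<Longrightarrow> s \<le> b \<Longrightarrow> \<phi> s \<le> s"
  shows "real n / 2 \<le> I (b / 2 ^ n) b"
proof (induction n)
  case (Suc n)
  have dom: "b / 2 ^ k \<in> gueb_dom \<tau>" "0 < b / 2 ^ k" "b / 2 ^ k \<le> b" for k :: nat
    using assms(1) dom_downward[OF assms(2), of "b / 2 ^ k"] by (auto simp: field_simps)
  \<comment> \<open>The length of each piece is half its right endpoint, so the piece contributes at
    least \<open>1 / 2\<close> regardless of \<open>n\<close>.\<close>
  have "1 / 2 = (b / 2 ^ n - b / 2 ^ Suc n) / (b / 2 ^ n)"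
    using assms(1) by (simp add: field_simps)
  also have "\<dots> \<le> (b / 2 ^ n - b / 2 ^ Suc n) / \<phi> (b / 2 ^ n)"
    using dom[of n] assms(3)[of "b / 2 ^ n"] pos[of "b / 2 ^ n"] assms(1)
    by (intro divide_left_mono) (auto simp: field_simps)
  also have "\<dots> \<le> I (b / 2 ^ Suc n) (b / 2 ^ n)"
    using dom[of n] dom[of "Suc n"] assms(1) by (intro I_bounds) (auto simp: field_simps)
  finally have "1 / 2 \<le> I (b / 2 ^ Suc n) (b / 2 ^ n)" .
  moreover have "I (b / 2 ^ Suc n) (b / 2 ^ n) + I (b / 2 ^ n) b = I (b / 2 ^ Suc n) b"
    using dom[of n] dom[of "Suc n"] assms(1,2) by (intro I_split) auto
  ultimately show ?case
    using Suc by (simp add: add_divide_distrib)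
qed simp

text \<open>The function \<phi> may jump, but the integral is Lipschitz in its lower limit with
  constant \<open>1 / \<phi> a\<close>. The intermediate value theorem is applied to it
  below.\<close>

lemma continuous_on_I:
  assumes "0 < a" "b \<in> gueb_dom \<tau>"
  shows "continuous_on {a..b} (\<lambda>t. I t t0)"
proof (cases "a \<le> b")
  case True
  have a: "a \<in> gueb_dom \<tau>"
    using True assms dom_downward[of b a] by auto
  have diff: "\<bar>I s t0 - I t t0\<bar> \<le> 1 / \<phi> a * \<bar>s - t\<bar>" if "s \<in> {a..b}" "t \<in> {a..b}" "s \<le> t" for s t
  proof -
    have st: "s \<in> gueb_dom \<tau>" "t \<in> gueb_dom \<tau>" "0 < s" "0 < t"
      using that assms dom_downward by auto
    have "I s t0 - I t t0 = I s t"
      using I_split[of s t t0] st t0 by simp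
    moreover have "0 \<le> I s t"
      using I_bounds(1)[of s t] st that(3) pos[of t] divide_nonneg_pos[of "t - s" "\<phi> t"] by linarith
    moreover have "I s t \<le> (t - s) / \<phi> a"
    proof -
      have "(t - s) / \<phi> s \<le> (t - s) / \<phi> a"
        using mono_onD[OF mono a st(1)] that pos[OF a assms(1)] pos[OF st(1,3)]
        by (intro divide_left_mono) auto
      then show ?thesis
        using I_bounds(2)[of s t] st that(3) by simp
    qed
    ultimately show ?thesis
      using that(3) by simp
  qed
  have "(1 / \<phi> a)-lipschitz_on {a..b} (\<lambda>t. I t t0)"
  proof (rule lipschitz_onI)
    fix s t assume "s \<in> {a..b}" "t \<in> {a..b}"
    then show "dist (I s t0) (I t t0) \<le> 1 / \<phi> a * dist s t"
      using diff[of s t] diff[of t s] by (cases "s \<le> t") (auto simp: dist_real_def abs_minus_commute)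
  qed (use pos[OF a assms(1)] in simp)
  then show ?thesis
    by (rule lipschitz_on_continuous_on)
qed simp

text \<open>The inverse is a \<open>the_inv_into\<close>, so its value is known only once a preimage
  is exhibited. Continuity provides one between \<open>b\<close> and a point close to
  \<open>0\<close>.\<close>

lemma gueb_Psi_inv:
  assumes "0 < b" "b \<in> gueb_dom \<tau>" "\<And>s. 0 < s \<Longrightarrow> s \<le> b \<Longrightarrow> \<phi> s \<le> s" "gueb_Psi \<phi> t0 b \<le> ereal v"
  shows "gueb_Psi_inv \<tau> \<phi> t0 (ereal v) \<in> gueb_dom \<tau>"
    and "gueb_Psi \<phi> t0 (gueb_Psi_inv \<tau> \<phi> t0 (ereal v)) = ereal v"
proof -
  \<comment> \<open>With this \<open>n\<close>, the integral from \<open>b / 2 ^ n\<close> to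
    \<open>b\<close>, which is at least \<open>n / 2\<close>, covers the difference
    \<open>v - I b t0\<close>.\<close>
  obtain n :: nat where n: "2 * (v - I b t0) \<le> real n"
    using real_arch_simple by blast
  define a where "a = b / 2 ^ n"
  have a: "0 < a" "a \<le> b" "a \<in> gueb_dom \<tau>"
    using assms(1) dom_downward[OF assms(2), of a] by (auto simp: a_def field_simps)
  have "v \<le> I a t0"
    using I_geometric_lower_bound[OF assms(1-3), of n] n I_split[of a b t0] a assms(1,2) t0
    by (simp add: a_def)
  moreover have "I b t0 \<le> v"
    using assms(1,4) by simp
  ultimately obtain z where z: "a \<le> z" "z \<le> b" "I z t0 = v"
    using IVT2'[of "\<lambda>t. I t t0" b v a] continuous_on_I[OF a(1) assms(2)] a(2) by auto
  then have "z \<in> gueb_dom \<tau>" "gueb_Psi \<phi> t0 z = ereal v"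
    using a dom_downward[OF assms(2), of z] by auto
  then have "gueb_Psi_inv \<tau> \<phi> t0 (ereal v) = z"
    unfolding gueb_Psi_inv_def using the_inv_into_f_f[OF gueb_Psi_inj_on] by metis
  then show "gueb_Psi_inv \<tau> \<phi> t0 (ereal v) \<in> gueb_dom \<tau>"
    and "gueb_Psi \<phi> t0 (gueb_Psi_inv \<tau> \<phi> t0 (ereal v)) = ereal v"
    using \<open>z \<in> gueb_dom \<tau>\<close> \<open>gueb_Psi \<phi> t0 z = ereal v\<close> by auto
qed

lemma le_gueb_Psi_inv:
  assumes "0 < b" "b \<in> gueb_dom \<tau>" "\<And>s. 0 < s \<Longrightarrow> s \<le> b \<Longrightarrow> \<phi> s \<le> s" "gueb_Psi \<phi> t0 b \<le> ereal v"
    and "a \<in> gueb_dom \<tau>" "ereal v \<le> gueb_Psi \<phi> t0 a"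
  shows "a \<le> gueb_Psi_inv \<tau> \<phi> t0 (ereal v)"
  using gueb_Psi_le_imp_ge[of "gueb_Psi_inv \<tau> \<phi> t0 (ereal v)" a] gueb_Psi_inv[OF assms(1-4)] assms(5,6)
  by simp

text \<open>Telescopes \<open>gueb_Psi_decrement\<close>. Extended reals cover a sequence that
  reaches \<open>0\<close>, where \<open>gueb_Psi\<close> is infinite.\<close>

lemma gueb_Psi_iterate:
  assumes "\<phi> 0 = 0" "\<And>n. Y n \<in> gueb_dom \<tau>" "\<And>n. 0 \<le> w n" "\<And>n. Y (Suc n) \<le> Y n - w n * \<phi> (Y n)"
  shows "gueb_Psi \<phi> t0 (Y 0) + ereal (\<Sum>k<n. w k) \<le> gueb_Psi \<phi> t0 (Y n)"
proof (induction n)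
  case (Suc n)
  have "gueb_Psi \<phi> t0 (Y 0) + ereal (\<Sum>k<Suc n. w k)
      = gueb_Psi \<phi> t0 (Y 0) + ereal (\<Sum>k<n. w k) + ereal (w n)"
    by (simp add: add.assoc)
  also have "\<dots> \<le> gueb_Psi \<phi> t0 (Y n) + ereal (w n)"
    by (intro add_right_mono Suc)
  also have "\<dots> \<le> gueb_Psi \<phi> t0 (Y (Suc n))"
    using assms(2)[of "Suc n"] assms by (intro gueb_Psi_decrement) (auto simp: gueb_dom_def)
  finally show ?case .
qed (simp add: zero_ereal_def[symmetric])

end

section \<open>Trials with conditional success probability bounded below\<close>

text \<open>The bound is given for each fixed index, whereas \<open>J\<close> is random. Since
  \<open>J\<close> is known given \<open>N\<close>, the weight \<open>W\<close> splits by the value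
  of \<open>J\<close> into finitely many \<open>N\<close>-measurable weights, each paired with a
  fixed index.\<close>

lemma (in prob_space) expectation_selected_ge:
  fixes W :: "'a \<Rightarrow> real" and i J :: "'a \<Rightarrow> 'i"
  assumes sub: "subalgebra M N" and I: "finite I"
    and J: "J \<in> N \<rightarrow>\<^sub>M count_space I" and i: "i \<in> M \<rightarrow>\<^sub>M count_space I"
    and cond: "\<And>j. j \<in> I \<Longrightarrow> AE \<omega> in M. real_cond_exp M N (indicator {\<omega>\<in>space M. i \<omega> = j}) \<omega> \<ge> \<rho>"
    and W: "W \<in> borel_measurable N" "\<And>\<omega>. \<omega> \<in> space M \<Longrightarrow> 0 \<le> W \<omega>" "\<And>\<omega>. \<omega> \<in> space M \<Longrightarrow> W \<omega> \<le> 1"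
  shows "\<rho> * expectation W \<le> expectation (\<lambda>\<omega>. W \<omega> * indicator {\<omega>\<in>space M. i \<omega> = J \<omega>} \<omega>)"
proof -
  interpret finite_measure_subalgebra M N
    by unfold_locales (rule sub)
  have space_N: "space N = space M"
    using sub by (simp add: subalgebra_def)
  have J_M: "J \<in> M \<rightarrow>\<^sub>M count_space I"
    by (rule measurable_from_subalg[OF sub J])
  have W_M[measurable]: "W \<in> borel_measurable M"
    by (rule measurable_from_subalg[OF sub W(1)])
  define f where "f j \<omega> = W \<omega> * indicator {\<omega>\<in>space M. J \<omega> = j} \<omega>" for j \<omega>
  define e :: "'i \<Rightarrow> 'a \<Rightarrow> real" where "e j = indicator {\<omega>\<in>space M. i \<omega> = j}" for j
  have set_J: "{\<omega>\<in>space M. J \<omega> = j} \<in> sets N" if "j \<in> I" for j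
    using measurable_sets[OF J, of "{j}"] that
    by (simp add: space_N vimage_def Int_def conj_commute)
  have set_i: "{\<omega>\<in>space M. i \<omega> = j} \<in> sets M" if "j \<in> I" for j
    using measurable_sets[OF i, of "{j}"] that by (simp add: vimage_def Int_def conj_commute)
  have f_N: "f j \<in> borel_measurable N" if "j \<in> I" for j
    unfolding f_def using W(1) set_J[OF that] by measurable
  have f_M: "f j \<in> borel_measurable M" if "j \<in> I" for j
    by (rule measurable_from_subalg[OF sub f_N[OF that]])
  have e_M: "e j \<in> borel_measurable M" if "j \<in> I" for j
    unfolding e_def using set_i[OF that] by measurable
  have f_bounds: "0 \<le> f j \<omega>" "f j \<omega> \<le> 1" if "\<omega> \<in> space M" for j \<omega>
    using W(2,3)[OF that] by (auto simp: f_def indicator_def)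
  have int_f: "integrable M (f j)" if "j \<in> I" for j
    using f_M[OF that] f_bounds by (intro integrable_const_bound[where B = 1]) auto
  have int_fe: "integrable M (\<lambda>\<omega>. f j \<omega> * e j \<omega>)" if "j \<in> I" for j
  proof (rule integrable_const_bound[where B = 1])
    show "AE \<omega> in M. norm (f j \<omega> * e j \<omega>) \<le> 1"
      using f_bounds by (auto simp: e_def indicator_def)
  qed (use f_M[OF that] e_M[OF that] in measurable)
  have "\<rho> * expectation W = \<rho> * expectation (\<lambda>\<omega>. \<Sum>j\<in>I. f j \<omega>)"
  proof (intro arg_cong[where f = "\<lambda>t. \<rho> * t"] Bochner_Integration.integral_cong refl)
    fix \<omega> assume \<omega>: "\<omega> \<in> space M"
    then have "J \<omega> \<in> I"
      using measurable_space[OF J_M] by simp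
    then have "(\<Sum>j\<in>I. f j \<omega>) = f (J \<omega>) \<omega>"
      by (intro sum.remove[OF I, THEN trans]) (auto simp: f_def indicator_def intro!: sum.neutral)
    then show "W \<omega> = (\<Sum>j\<in>I. f j \<omega>)"
      using \<omega> by (simp add: f_def)
  qed
  also have "\<dots> = (\<Sum>j\<in>I. \<rho> * expectation (f j))"
    by (simp add: Bochner_Integration.integral_sum int_f sum_distrib_left)
  also have "\<dots> \<le> (\<Sum>j\<in>I. expectation (\<lambda>\<omega>. f j \<omega> * e j \<omega>))"
  proof (rule sum_mono)
    fix j assume j: "j \<in> I"
    have "\<rho> * expectation (f j) = expectation (\<lambda>\<omega>. f j \<omega> * \<rho>)"
      by simp
    \<comment> \<open>The weight \<open>f j\<close> is \<open>N\<close>-measurable, so under the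
      expectation the conditional expectation of \<open>e j\<close> may replace
      \<open>e j\<close>.\<close>
    also have "\<dots> \<le> expectation (\<lambda>\<omega>. f j \<omega> * real_cond_exp M N (e j) \<omega>)"
    proof (rule integral_mono_AE)
      show "integrable M (\<lambda>\<omega>. f j \<omega> * real_cond_exp M N (e j) \<omega>)"
        by (rule real_cond_exp_intg(1)[OF int_fe f_N e_M]) (rule j)+
      show "AE \<omega> in M. f j \<omega> * \<rho> \<le> f j \<omega> * real_cond_exp M N (e j) \<omega>"
        using cond[OF j] AE_space unfolding e_def
        by eventually_elim (intro mult_left_mono f_bounds)
    qed (use int_f[OF j] in simp)
    also have "\<dots> = expectation (\<lambda>\<omega>. f j \<omega> * e j \<omega>)"
      by (rule real_cond_exp_intg(2)[OF int_fe f_N e_M]) (rule j)+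
    finally show "\<rho> * expectation (f j) \<le> expectation (\<lambda>\<omega>. f j \<omega> * e j \<omega>)" .
  qed
  also have "\<dots> = expectation (\<lambda>\<omega>. \<Sum>j\<in>I. f j \<omega> * e j \<omega>)"
    by (simp add: Bochner_Integration.integral_sum int_fe)
  also have "\<dots> = expectation (\<lambda>\<omega>. W \<omega> * indicator {\<omega>\<in>space M. i \<omega> = J \<omega>} \<omega>)"
  proof (intro Bochner_Integration.integral_cong refl)
    fix \<omega> assume \<omega>: "\<omega> \<in> space M"
    then have "J \<omega> \<in> I"
      using measurable_space[OF J_M] by simp
    then have "(\<Sum>j\<in>I. f j \<omega> * e j \<omega>) = f (J \<omega>) \<omega> * e (J \<omega>) \<omega>"
      by (intro sum.remove[OF I, THEN trans]) (auto simp: f_def indicator_def intro!: sum.neutral)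
    then show "(\<Sum>j\<in>I. f j \<omega> * e j \<omega>) = W \<omega> * indicator {\<omega>\<in>space M. i \<omega> = J \<omega>} \<omega>"
      using \<omega> by (simp add: f_def e_def indicator_def)
  qed
  finally show ?thesis .
qed

text \<open>
  The last assumption says that the conditional probability of \<open>E k\<close> given \<open>\<F> k\<close> is at least \<open>\<rho>\<close>,
  tested against bounded weights.
\<close>

locale biased_trials = prob_space M for M :: "'w measure" +
  fixes \<F> :: "nat \<Rightarrow> 'w measure" and E :: "nat \<Rightarrow> 'w set" and \<rho> :: real
    and \<beta> :: "nat \<Rightarrow> real" and \<beta>bar :: real
  assumes filtration: "filtration (space M) \<F>"
    and subalgebra: "subalgebra M (\<F> k)"
    and E_sets: "E k \<in> sets (\<F> (Suc k))"
    and \<rho>_pos: "0 < \<rho>"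
    and \<beta>_pos: "0 < \<beta> k" and \<beta>_le: "\<beta> k \<le> \<beta>bar"
    and E_prob: "W \<in> borel_measurable (\<F> k) \<Longrightarrow> (\<And>\<omega>. \<omega> \<in> space M \<Longrightarrow> 0 \<le> W \<omega>) \<Longrightarrow>
      (\<And>\<omega>. \<omega> \<in> space M \<Longrightarrow> W \<omega> \<le> 1) \<Longrightarrow>
      \<rho> * expectation W \<le> expectation (\<lambda>\<omega>. W \<omega> * indicator (E k) \<omega>)"
begin

definition A :: "nat \<Rightarrow> real" where
  "A n = (\<Sum>k<n. \<beta> k)"

definition R :: "nat \<Rightarrow> 'w \<Rightarrow> real" where
  "R n \<omega> = (\<Sum>k<n. \<beta> k * indicator (E k) \<omega>)"

lemma \<beta>bar_pos: "0 < \<beta>bar"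
  using \<beta>_pos[of 0] \<beta>_le[of 0] by simp

lemma A_nonneg: "0 \<le> A n"
  unfolding A_def by (intro sum_nonneg less_imp_le[OF \<beta>_pos])

lemma R_nonneg: "0 \<le> R n \<omega>"
  unfolding R_def by (intro sum_nonneg mult_nonneg_nonneg less_imp_le[OF \<beta>_pos]) simp

lemma R_mono: "k \<le> n \<Longrightarrow> R k \<omega> \<le> R n \<omega>"
  unfolding R_def by (intro sum_mono2) (auto intro!: mult_nonneg_nonneg less_imp_le[OF \<beta>_pos])

lemma R_adapted: "R n \<in> borel_measurable (\<F> n)"
proof -
  have "E k \<in> sets (\<F> n)" if "k < n" for k
    using E_sets[of k] filtration.sets_F_mono[OF filtration, of "Suc k" n] that by auto
  then show ?thesis
    unfolding R_def by (intro borel_measurable_sum borel_measurable_times borel_measurable_const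
        borel_measurable_indicator) auto
qed

lemma R_measurable [measurable]: "R n \<in> borel_measurable M"
  by (rule measurable_from_subalg[OF subalgebra R_adapted])

lemma E_events [measurable]: "E k \<in> sets M"
  using E_sets[of k] subalgebra[of "Suc k"] by (auto simp: subalgebra_def)

text \<open>
  The Chernoff parameter \<open>ln 2 / \<beta>bar\<close> is what produces the constant \<open>(1 - ln 2) / 2\<close>.
\<close>

definition \<eta> :: real where
  "\<eta> = ln 2 / \<beta>bar"

lemma \<eta>_pos: "0 < \<eta>"
  using \<beta>bar_pos by (simp add: \<eta>_def)

lemma integrable_exp_R: "integrable M (\<lambda>\<omega>. exp (- \<eta> * R n \<omega>))"
  using R_nonneg \<eta>_pos by (intro integrable_const_bound[where B = 1]) auto

text \<open>The exponential lies below its chord between \<open>- ln 2\<close> and \<open>0\<close>,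
  and \<open>exp (- ln 2) = 1 / 2\<close>; the position along the chord is
  \<open>\<beta> k / \<beta>bar\<close>.\<close>

lemma one_minus_exp_ge: "\<beta> k / (2 * \<beta>bar) \<le> 1 - exp (- \<eta> * \<beta> k)"
proof -
  define u where "u = \<beta> k / \<beta>bar"
  have u: "0 \<le> u" "u \<le> 1"
    using \<beta>_pos[of k] \<beta>_le[of k] \<beta>bar_pos by (auto simp: u_def)
  have "exp ((1 - u) *\<^sub>R 0 + u *\<^sub>R (- ln 2)) \<le> (1 - u) * exp 0 + u * exp (- ln 2 :: real)"
    using u by (intro convex_onD[OF exp_convex]) auto
  moreover have "- \<eta> * \<beta> k = u * (- ln 2)"
    by (simp add: u_def \<eta>_def)
  ultimately have "exp (- \<eta> * \<beta> k) \<le> 1 - u / 2"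
    by (simp add: exp_minus)
  then show ?thesis
    by (simp add: u_def)
qed

text \<open>Conditioning takes the place of independence: the adapted factor
  \<open>exp (- \<eta> * R n \<omega>)\<close> serves as the weight in \<open>E_prob\<close>, and
  each step contributes a factor of at most \<open>1 - q * \<rho>\<close>.\<close>

lemma expectation_exp_R: "expectation (\<lambda>\<omega>. exp (- \<eta> * R n \<omega>)) \<le> exp (- \<rho> * A n / (2 * \<beta>bar))"
proof (induction n)
  case 0
  then show ?case
    by (simp add: R_def A_def prob_space)
next
  case (Suc n)
  let ?W = "\<lambda>\<omega>. exp (- \<eta> * R n \<omega>)"
  define q where "q = 1 - exp (- \<eta> * \<beta> n)"
  have q: "\<beta> n / (2 * \<beta>bar) \<le> q"
    unfolding q_def by (rule one_minus_exp_ge)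
  have "0 \<le> \<beta> n / (2 * \<beta>bar)"
    using \<beta>_pos[of n] \<beta>bar_pos by simp
  then have q0: "0 \<le> q"
    using q by simp
  have int: "integrable M (\<lambda>\<omega>. ?W \<omega> * indicator (E n) \<omega>)"
    by (rule integrable_real_mult_indicator[OF E_events integrable_exp_R])
  \<comment> \<open>The exponential is multiplied by \<open>1 - q\<close> on \<open>E n\<close> and
    is unchanged elsewhere.\<close>
  have "expectation (\<lambda>\<omega>. exp (- \<eta> * R (Suc n) \<omega>)) = expectation (\<lambda>\<omega>. ?W \<omega> - q * (?W \<omega> * indicator (E n) \<omega>))"
    by (intro Bochner_Integration.integral_cong)
      (auto simp: R_def q_def indicator_def algebra_simps simp flip: exp_add)
  also have "\<dots> = expectation ?W - q * expectation (\<lambda>\<omega>. ?W \<omega> * indicator (E n) \<omega>)"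
    using integrable_exp_R int by simp
  also have "\<dots> \<le> expectation ?W - q * (\<rho> * expectation ?W)"
  proof (intro diff_left_mono mult_left_mono q0 E_prob)
    show "?W \<in> borel_measurable (\<F> n)"
      using R_adapted by measurable
    show "?W \<omega> \<le> 1" for \<omega>
      using R_nonneg \<eta>_pos by simp
  qed simp
  also have "\<dots> = (1 - q * \<rho>) * expectation ?W"
    by (simp add: algebra_simps)
  also have "\<dots> \<le> exp (- \<rho> * \<beta> n / (2 * \<beta>bar)) * expectation ?W"
  proof (rule mult_right_mono)
    have "1 - q * \<rho> \<le> exp (- (q * \<rho>))"
      using exp_ge_add_one_self[of "- (q * \<rho>)"] by simp
    also have "\<dots> \<le> exp (- \<rho> * \<beta> n / (2 * \<beta>bar))"
      using mult_left_mono[OF q less_imp_le[OF \<rho>_pos]] by (simp add: mult.commute)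
    finally show "1 - q * \<rho> \<le> exp (- \<rho> * \<beta> n / (2 * \<beta>bar))" .
  qed (simp add: integral_nonneg_AE)
  also have "\<dots> \<le> exp (- \<rho> * \<beta> n / (2 * \<beta>bar)) * exp (- \<rho> * A n / (2 * \<beta>bar))"
    by (intro mult_left_mono Suc) simp
  also have "\<dots> = exp (- \<rho> * A (Suc n) / (2 * \<beta>bar))"
    by (simp add: A_def algebra_simps add_divide_distrib diff_divide_distrib flip: exp_add)
  finally show ?case .
qed

text \<open>Markov's inequality for \<open>exp (- \<eta> * R n \<omega>)\<close>. The threshold
  stays free because two are used: \<open>\<rho> * A n / 2\<close> for the bound in expectation, and
  a larger multiple of \<open>\<rho> * A n\<close> for the almost sure one.\<close>

lemma prob_R_less:
  "prob {\<omega>\<in>space M. R n \<omega> < c} \<le> exp (\<eta> * c - \<rho> * A n / (2 * \<beta>bar))"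
proof -
  have "prob {\<omega>\<in>space M. R n \<omega> < c} \<le> prob {\<omega>\<in>space M. exp (- \<eta> * R n \<omega>) \<ge> exp (- \<eta> * c)}"
    using \<eta>_pos by (intro finite_measure_mono) auto
  also have "\<dots> \<le> expectation (\<lambda>\<omega>. exp (- \<eta> * R n \<omega>)) / exp (- \<eta> * c)"
    by (rule integral_Markov_inequality_measure[OF integrable_exp_R]) auto
  also have "\<dots> \<le> exp (- \<rho> * A n / (2 * \<beta>bar)) / exp (- \<eta> * c)"
    by (intro divide_right_mono expectation_exp_R) simp
  also have "\<dots> = exp (\<eta> * c - \<rho> * A n / (2 * \<beta>bar))"
    by (simp flip: exp_diff)
  finally show ?thesis .
qed

lemma prob_R_less_half:
  "prob {\<omega>\<in>space M. R n \<omega> < \<rho> * A n / 2} \<le> exp (- ((1 - ln 2) / 2) * (\<rho> / \<beta>bar) * A n)"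
proof -
  have "\<eta> * (\<rho> * A n / 2) - \<rho> * A n / (2 * \<beta>bar) = - ((1 - ln 2) / 2) * (\<rho> / \<beta>bar) * A n"
    using \<beta>bar_pos by (simp add: \<eta>_def field_simps)
  then show ?thesis
    using prob_R_less[of n "\<rho> * A n / 2"] by simp
qed

text \<open>
  Since \<open>1 / (2 ln 2) > 1/2\<close>, the Chernoff bound stays summable for a constant \<open>\<theta>\<close> slightly
  larger than \<open>1/2\<close> along the first times at which \<open>A\<close> passes the integers. Monotonicity of \<open>R\<close> fills
  the gaps, and the surplus \<open>\<theta> - 1/2\<close> absorbs the constant \<open>c\<close>.
\<close>

lemma AE_eventually_R_ge:
  assumes A_lim: "filterlim A at_top sequentially"
  shows "AE \<omega> in M. \<forall>\<^sub>F n in sequentially. \<rho> / 2 * A n + c \<le> R n \<omega>"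
proof -
  \<comment> \<open>The midpoint of \<open>1 / 2\<close> and \<open>1 / (2 * ln 2)\<close>.\<close>
  define \<theta> :: real where "\<theta> = (1 + 1 / ln 2) / 4"
  have ln2: "0 < ln (2 :: real)" "ln (2 :: real) < 1"
    using ln_2_less_1 by auto
  have \<theta>: "1 / 2 < \<theta>" "\<theta> * ln 2 < 1 / 2"
    using ln2 by (auto simp: \<theta>_def field_simps)
  \<comment> \<open>The exponent that the Chernoff bound leaves per unit of \<open>A\<close> at the
    threshold \<open>\<theta> * \<rho> * A n\<close>.\<close>
  define r where "r = (1 / 2 - \<theta> * ln 2) * \<rho> / \<beta>bar"
  have r: "0 < r"
    using \<theta>(2) \<rho>_pos \<beta>bar_pos by (simp add: r_def)
  define K where "K n = (LEAST k. real n \<le> A k)" for n :: nat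
  have ex: "\<exists>k. real n \<le> A k" for n
    using A_lim unfolding filterlim_at_top eventually_sequentially by blast
  have K_ge: "real n \<le> A (K n)" for n
    unfolding K_def using ex by (rule LeastI_ex)
  have K_le: "K n \<le> k" if "real n \<le> A k" for n k
    unfolding K_def using that by (rule Least_le)
  define B where "B n = {\<omega>\<in>space M. R (K n) \<omega> < \<theta> * \<rho> * A (K n)}" for n
  have B_sets [measurable]: "B n \<in> sets M" for n
    unfolding B_def by measurable
  have B_prob: "prob (B n) \<le> exp (- r) ^ n" for n
  proof -
    have "prob (B n) \<le> exp (\<eta> * (\<theta> * \<rho> * A (K n)) - \<rho> * A (K n) / (2 * \<beta>bar))"
      unfolding B_def by (rule prob_R_less)
    also have "\<eta> * (\<theta> * \<rho> * A (K n)) - \<rho> * A (K n) / (2 * \<beta>bar) = - (r * A (K n))"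
      using \<beta>bar_pos by (simp add: \<eta>_def r_def field_simps)
    also have "exp (- (r * A (K n))) \<le> exp (- (r * real n))"
      using K_ge[of n] r by simp
    also have "\<dots> = exp (- r) ^ n"
      by (simp add: exp_of_nat_mult[symmetric] mult.commute)
    finally show ?thesis .
  qed
  have "AE \<omega> in M. \<forall>\<^sub>F n in sequentially. \<omega> \<in> space M - B n"
  proof (rule borel_cantelli_AE1)
    show "summable (\<lambda>n. prob (B n))"
      by (rule summable_comparison_test'[OF summable_geometric[of "exp (- r)"], of 0]) (use B_prob r in auto)
  qed (auto simp: emeasure_eq_measure)
  then show ?thesis
  proof eventually_elim
    case (elim \<omega>)
    then obtain N where N: "\<And>n. n \<ge> N \<Longrightarrow> \<omega> \<in> space M - B n"
      by (auto simp: eventually_sequentially)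
    \<comment> \<open>The first bound puts the integer part of \<open>A k\<close> beyond
      \<open>N\<close>; the second makes the surplus
      \<open>(\<theta> - 1 / 2) * \<rho> * A k\<close> cover both \<open>c\<close> and the rounding
      loss \<open>\<theta> * \<rho>\<close>.\<close>
    have "\<forall>\<^sub>F k in sequentially. max (real N) ((\<theta> * \<rho> + c) / ((\<theta> - 1 / 2) * \<rho>)) \<le> A k"
      using A_lim unfolding filterlim_at_top by blast
    then show ?case
    proof eventually_elim
      case (elim k)
      define n where "n = nat \<lfloor>A k\<rfloor>"
      have n: "real n \<le> A k" "A k \<le> real n + 1"
        using A_nonneg[of k] by (auto simp: n_def)
      have "N \<le> n"
        using elim unfolding n_def by (simp add: le_nat_floor)
      then have "\<theta> * \<rho> * A (K n) \<le> R (K n) \<omega>"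
        using N[of n] by (auto simp: B_def)
      also have "\<dots> \<le> R k \<omega>"
        by (intro R_mono K_le n)
      finally have "\<theta> * \<rho> * A (K n) \<le> R k \<omega>" .
      moreover have "\<theta> * \<rho> * (A k - 1) \<le> \<theta> * \<rho> * A (K n)"
        using n K_ge[of n] \<theta>(1) \<rho>_pos by (intro mult_left_mono) auto
      moreover have "\<theta> * \<rho> + c \<le> A k * ((\<theta> - 1 / 2) * \<rho>)"
        using elim \<theta>(1) \<rho>_pos by (simp add: pos_divide_le_eq)
      ultimately show ?case
        by (simp add: algebra_simps)
    qed
  qed
qed

end

section \<open>The randomized Krasnoselskii--Mann method\<close>

text \<open>Nonnegativity of the variance.\<close>

lemma (in prob_space) expectation_le_sqrt_expectation_power2:
  fixes X :: "'a \<Rightarrow> real"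
  assumes "integrable M X" "integrable M (\<lambda>\<omega>. (X \<omega>)\<^sup>2)"
  shows "expectation X \<le> sqrt (expectation (\<lambda>\<omega>. (X \<omega>)\<^sup>2))"
  using variance_positive[of X] variance_eq[OF assms] by (intro real_le_rsqrt) simp

text \<open>The index \<open>K\<close> is the first time from which \<open>P\<close> holds forever,
  and infinite where there is none. The infinite value makes the last conclusion true for every
  \<omega>, not only almost surely.\<close>

lemma AE_eventually_random_index:
  fixes P :: "nat \<Rightarrow> 'w \<Rightarrow> bool"
  assumes [measurable]: "\<And>n. Measurable.pred M (P n)"
    and ev: "AE \<omega> in M. \<forall>\<^sub>F n in sequentially. P n \<omega>"
  obtains K :: "'w \<Rightarrow> enat" where "K \<in> M \<rightarrow>\<^sub>M count_space UNIV" "AE \<omega> in M. K \<omega> < \<infinity>"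
    "\<And>\<omega> n. K \<omega> \<le> enat n \<Longrightarrow> P n \<omega>"
proof -
  define Q where "Q n \<omega> = (\<forall>k\<ge>n. P k \<omega>)" for n \<omega>
  define K where "K \<omega> = (if \<exists>n. Q n \<omega> then enat (LEAST n. Q n \<omega>) else \<infinity>)" for \<omega>
  have [measurable]: "Measurable.pred M (Q n)" for n
    unfolding Q_def by measurable
  have 1: "K \<in> M \<rightarrow>\<^sub>M count_space UNIV"
    unfolding K_def by measurable
  have 2: "AE \<omega> in M. K \<omega> < \<infinity>"
    using ev by eventually_elim (auto simp: K_def Q_def eventually_sequentially)
  have 3: "P n \<omega>" if "K \<omega> \<le> enat n" for \<omega> n
  proof -
    have ex: "\<exists>k. Q k \<omega>"
      using that by (auto simp: K_def split: if_splits)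
    define L where "L = (LEAST k. Q k \<omega>)"
    have "Q L \<omega>"
      unfolding L_def using ex by (rule LeastI_ex)
    moreover have "L \<le> n"
      using that ex by (simp add: K_def L_def)
    ultimately show ?thesis
      unfolding Q_def by blast
  qed
  show thesis
    using 1 2 3 by (rule that)
qed

text \<open>Taking the least index among the maximizers makes the choice measurable.\<close>

lemma Max_attained_selection:
  fixes f :: "nat \<Rightarrow> 'a \<Rightarrow> real"
  assumes m: "1 \<le> m" and meas: "\<And>j. j \<in> {1..m} \<Longrightarrow> f j \<in> borel_measurable N"
  obtains J where "J \<in> N \<rightarrow>\<^sub>M count_space {1..m}" "\<And>z. J z \<in> {1..m}"
    "\<And>z. f (J z) z = Max ((\<lambda>j. f j z) ` {1..m})"
proof -
  let ?P = "\<lambda>j z. j \<in> {1..m} \<and> f j z = Max ((\<lambda>j. f j z) ` {1..m})"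
  define J where "J z = (LEAST j. ?P j z)" for z
  have "\<exists>j. ?P j z" for z
  proof -
    have "Max ((\<lambda>j. f j z) ` {1..m}) \<in> (\<lambda>j. f j z) ` {1..m}"
      using m by (intro Max_in) auto
    then show ?thesis
      unfolding image_iff by metis
  qed
  then have J: "?P (J z) z" for z
    unfolding J_def by (rule LeastI_ex)
  then have J_range: "J z \<in> {1..m}" and J_Max: "f (J z) z = Max ((\<lambda>j. f j z) ` {1..m})" for z
    by blast+
  have Max: "(\<lambda>z. Max ((\<lambda>j. f j z) ` {1..m})) \<in> borel_measurable N"
    by (intro borel_measurable_Max meas) auto
  have pred: "Measurable.pred N (?P j)" for j
  proof (cases "j \<in> {1..m}")
    case True
    then show ?thesis
      using borel_measurable_eq[OF meas Max, of j] by (simp add: pred_def)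
  next
    case False
    then have "?P j = (\<lambda>_. False)"
      by blast
    then show ?thesis
      by simp
  qed
  have "J \<in> N \<rightarrow>\<^sub>M count_space UNIV"
    unfolding J_def by (rule measurable_Least[of ?P, OF pred])
  then have "J \<in> N \<rightarrow>\<^sub>M count_space {1..m}"
    using J_range by (intro measurable_count_space_extend[of "{1..m}" UNIV]) auto
  then show thesis
    using J_range J_Max by (rule that)
qed

text \<open>Integrability is claimed along with the integrals because a non-integrable function has
  integral \<open>0\<close> by convention. The random indices are \<open>enat\<close>-valued, so
  they may be infinite on a null set.\<close>

theorem theorem13:
  fixes T :: "nat \<Rightarrow> real ^ 'd \<Rightarrow> real ^ 'd"
    and m :: nat
    and x0 :: "real ^ 'd"
    and \<beta> :: "nat \<Rightarrow> real" and \<beta>bar \<rho> :: real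
    and M :: "'w measure" and \<F> :: "nat \<Rightarrow> 'w measure"
    and i :: "nat \<Rightarrow> 'w \<Rightarrow> nat"
    and x :: "nat \<Rightarrow> 'w \<Rightarrow> real ^ 'd"
    and \<tau> :: ereal and \<phi> :: "real \<Rightarrow> real" and t0 :: real
  defines "F \<equiv> (\<Inter>j\<in>{1..m}. Fix (T j))"
  defines "p0 \<equiv> closest_point F x0"
  defines "h0 \<equiv> (infdist x0 F)\<^sup>2"
  defines "S \<equiv> cball p0 (infdist x0 F)"
  defines "h \<equiv> \<lambda>z. (infdist z F)\<^sup>2"
  defines "g \<equiv> \<lambda>z. Max ((\<lambda>j. (norm (T j z - z))\<^sup>2) ` {1..m})"
  defines "A \<equiv> \<lambda>k. \<Sum>j<k. \<beta> j"
  defines "\<hh> \<equiv> (1 - ln 2) / 2 :: real"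
  defines "\<Psi> \<equiv> gueb_Psi \<phi> t0"
  defines "\<Psi>inv \<equiv> gueb_Psi_inv \<tau> \<phi> t0"
  assumes m: "1 \<le> m"
    and T_cont: "\<And>j. j \<in> {1..m} \<Longrightarrow> continuous_on UNIV (T j)"
    and T_fqne: "\<And>j. j \<in> {1..m} \<Longrightarrow> firmly_quasi_nonexpansive (T j)"
    and F_nonempty: "F \<noteq> {}"
    and x0: "x0 \<notin> F"
    and prob: "prob_space M"
    and filtration: "filtration (space M) \<F>"
    and subalgebra: "\<And>k. subalgebra M (\<F> k)"
    and i_meas: "\<And>k. i k \<in> \<F> (Suc k) \<rightarrow>\<^sub>M count_space {1..m}"
    and x_0: "\<And>\<omega>. \<omega> \<in> space M \<Longrightarrow> x 0 \<omega> = x0"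
    and x_Suc: "\<And>k \<omega>. \<omega> \<in> space M \<Longrightarrow>
                  x (Suc k) \<omega> = x k \<omega> + \<beta> k *\<^sub>R (T (i k \<omega>) (x k \<omega>) - x k \<omega>)"
    and \<beta>_pos: "\<And>k. 0 < \<beta> k" and \<beta>_le: "\<And>k. \<beta> k \<le> \<beta>bar" and \<beta>bar: "\<beta>bar < 2"
    and \<beta>_sum: "filterlim (\<lambda>n. \<Sum>k<n. \<beta> k) at_top sequentially"
    and \<rho>: "0 < \<rho>"
    and i_prob: "\<And>j k. j \<in> {1..m} \<Longrightarrow>
                   AE \<omega> in M. real_cond_exp M (\<F> k) (indicator {\<omega>\<in>space M. i k \<omega> = j}) \<omega> \<ge> \<rho>"
    and \<phi>: "gueb_modulus S h g \<tau> \<phi>"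
    and t0: "0 < t0" "ereal t0 < \<tau>"
  shows "(\<forall>k\<ge>1.
            integrable M (\<lambda>\<omega>. (infdist (x k \<omega>) F)\<^sup>2) \<and>
            (\<integral>\<omega>. (infdist (x k \<omega>) F)\<^sup>2 \<partial>M)
              \<le> exp (- \<hh> * (\<rho> / \<beta>bar) * A k) * h0
                 + \<Psi>inv (\<Psi> h0 + ereal ((2 - \<beta>bar) * \<rho> / 2 * A k)))
       \<and> (\<exists>K1 :: 'w \<Rightarrow> enat. K1 \<in> M \<rightarrow>\<^sub>M count_space UNIV \<and>
            (AE \<omega> in M. K1 \<omega> < \<infinity>) \<and>
            (AE \<omega> in M. \<forall>k. K1 \<omega> \<le> enat k \<longrightarrow>
               (infdist (x k \<omega>) F)\<^sup>2 \<le> \<Psi>inv (ereal ((2 - \<beta>bar) * \<rho> / 2 * A k))))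
       \<and> (\<exists>xstar :: 'w \<Rightarrow> real ^ 'd. xstar \<in> borel_measurable M \<and>
            (\<forall>\<omega>\<in>space M. xstar \<omega> \<in> F) \<and>
            (AE \<omega> in M. (\<lambda>k. x k \<omega>) \<longlonglongrightarrow> xstar \<omega>) \<and>
            integrable M xstar \<and> (\<forall>k. integrable M (x k)) \<and>
            (\<lambda>k. \<integral>\<omega>. norm (x k \<omega> - xstar \<omega>) \<partial>M) \<longlonglongrightarrow> 0 \<and>
            (\<forall>k. (\<integral>\<omega>. norm (x k \<omega> - xstar \<omega>) \<partial>M)
                   \<le> 2 * sqrt (\<integral>\<omega>. (infdist (x k \<omega>) F)\<^sup>2 \<partial>M)) \<and>
            (\<exists>K2 :: 'w \<Rightarrow> enat. K2 \<in> M \<rightarrow>\<^sub>M count_space UNIV \<and>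
               (AE \<omega> in M. K2 \<omega> < \<infinity>) \<and>
               (AE \<omega> in M. \<forall>k. K2 \<omega> \<le> enat k \<longrightarrow>
                  norm (x k \<omega> - xstar \<omega>)
                    \<le> 2 * sqrt (\<Psi>inv (ereal ((2 - \<beta>bar) * \<rho> / 2 * A k))))))"
proof -
  interpret prob_space M
    by (rule prob)
  let ?I = "{1..m}"
  define D where "D = infdist x0 F"
  define Y where "Y k \<omega> = h (x k \<omega>)" for k \<omega>
  define c where "c = (2 - \<beta>bar) * \<rho> / 2"

  \<comment> \<open>Geometry of \<open>F\<close> and of the ball \<open>S\<close>\<close>
  have F_Fix: "F \<subseteq> Fix (T j)" if "j \<in> ?I" for j
    using that by (auto simp: F_def)
  have F_closed: "closed F"
    unfolding F_def by (intro closed_INT ballI closed_Fix T_fqne)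
  have F_convex: "convex F"
    unfolding F_def by (intro convex_INT convex_Fix T_fqne)
  have p0: "p0 \<in> F"
    unfolding p0_def by (rule closest_point_in_set[OF F_closed F_nonempty])
  have D_dist: "dist x0 p0 = D"
    unfolding D_def p0_def by (rule infdist_eq_dist_closest_point[OF F_closed F_nonempty, symmetric])
  have D_pos: "0 < D"
    unfolding D_def using x0 by (rule infdist_pos_not_in_closed[OF F_closed F_nonempty])
  have h0_D: "h0 = D\<^sup>2"
    by (simp add: h0_def D_def)
  have h0_pos: "0 < h0"
    using D_pos by (simp add: h0_D)
  have S_iff: "z \<in> S \<longleftrightarrow> dist p0 z \<le> D" for z
    by (simp add: S_def D_def)
  have S_iff': "z \<in> S \<longleftrightarrow> dist z p0 \<le> D" for z
    by (simp add: S_iff dist_commute)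
  have infdist_S: "infdist z F \<le> D" if "z \<in> S" for z
    using that infdist_le[OF p0, of z] by (simp add: S_iff')
  have sqrt_h: "sqrt (h z) = infdist z F" for z
    by (simp add: h_def infdist_nonneg)
  have h_nonneg: "0 \<le> h z" for z
    by (simp add: h_def)

  \<comment> \<open>Fejer monotonicity and descent of the squared distance\<close>
  have i_range: "i k \<omega> \<in> ?I" if "\<omega> \<in> space M" for k \<omega>
    using measurable_space[OF i_meas[of k], of \<omega>] that filtration.space_F[OF filtration] by simp
  have step: "(norm (x (Suc k) \<omega> - y))\<^sup>2
      \<le> (norm (x k \<omega> - y))\<^sup>2 - \<beta> k * (2 - \<beta>bar) * (norm (T (i k \<omega>) (x k \<omega>) - x k \<omega>))\<^sup>2"
    if "\<omega> \<in> space M" "y \<in> F" for k \<omega> y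
  proof -
    have "(norm (x (Suc k) \<omega> - y))\<^sup>2
        \<le> (norm (x k \<omega> - y))\<^sup>2 - \<beta> k * (2 - \<beta> k) * (norm (T (i k \<omega>) (x k \<omega>) - x k \<omega>))\<^sup>2"
      unfolding x_Suc[OF that(1)]
      using i_range[OF that(1), of k] F_Fix that(2) \<beta>_pos[of k]
      by (intro relaxed_step_norm_le T_fqne) auto
    \<comment> \<open>Replacing \<open>2 - \<beta> k\<close> by \<open>2 - \<beta>bar\<close> only
      weakens the decrease and makes its constant uniform.\<close>
    moreover have "\<beta> k * (2 - \<beta>bar) * (norm (T (i k \<omega>) (x k \<omega>) - x k \<omega>))\<^sup>2
        \<le> \<beta> k * (2 - \<beta> k) * (norm (T (i k \<omega>) (x k \<omega>) - x k \<omega>))\<^sup>2"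
      using \<beta>_le[of k] \<beta>_pos[of k] by (intro mult_right_mono mult_left_mono) auto
    ultimately show ?thesis
      by linarith
  qed
  have fejer: "dist (x (Suc k) \<omega>) y \<le> dist (x k \<omega>) y" if "\<omega> \<in> space M" "y \<in> F" for k \<omega> y
  proof -
    have "0 \<le> \<beta> k * (2 - \<beta>bar) * (norm (T (i k \<omega>) (x k \<omega>) - x k \<omega>))\<^sup>2"
      using \<beta>_pos[of k] \<beta>bar by simp
    then have "(norm (x (Suc k) \<omega> - y))\<^sup>2 \<le> (norm (x k \<omega> - y))\<^sup>2"
      using step[OF that, of k] by linarith
    then show ?thesis
      unfolding dist_norm by (rule power2_le_imp_le) simp
  qed
  have in_S: "x k \<omega> \<in> S" if "\<omega> \<in> space M" for k \<omega>
  proof (induction k)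
    case 0
    then show ?case
      by (simp add: S_iff' x_0[OF that] D_dist)
  next
    case (Suc k)
    then show ?case
      using fejer[OF that p0, of k] by (simp add: S_iff')
  qed
  have Y_step: "Y (Suc k) \<omega> \<le> Y k \<omega> - \<beta> k * (2 - \<beta>bar) * (norm (T (i k \<omega>) (x k \<omega>) - x k \<omega>))\<^sup>2"
    if "\<omega> \<in> space M" for k \<omega>
  proof -
    \<comment> \<open>Testing with the projection of the current iterate is exact at step
      \<open>k\<close> and gives an upper bound at step \<open>Suc k\<close>.\<close>
    define q where "q = closest_point F (x k \<omega>)"
    have q: "q \<in> F"
      unfolding q_def by (rule closest_point_in_set[OF F_closed F_nonempty])
    have "Y (Suc k) \<omega> \<le> (norm (x (Suc k) \<omega> - q))\<^sup>2"
      unfolding Y_def h_def using infdist_le[OF q, of "x (Suc k) \<omega>"]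
      by (intro power_mono) (auto simp: dist_norm infdist_nonneg)
    moreover have "Y k \<omega> = (norm (x k \<omega> - q))\<^sup>2"
      unfolding Y_def h_def q_def
      by (simp add: infdist_eq_dist_closest_point[OF F_closed F_nonempty] dist_norm)
    ultimately show ?thesis
      using step[OF that q, of k] by linarith
  qed

  \<comment> \<open>The modulus on \<open>S\<close> and the range of the rate function\<close>
  have INF_h: "(INF z\<in>S. h z) = 0"
  proof (rule antisym)
    have "(INF z\<in>S. h z) \<le> h p0"
      using D_pos by (intro cINF_lower bdd_belowI[of _ 0]) (auto simp: h_nonneg S_iff)
    then show "(INF z\<in>S. h z) \<le> 0"
      using p0 by (simp add: h_def)
    show "0 \<le> (INF z\<in>S. h z)"
      using D_pos by (intro cINF_greatest h_nonneg) (auto simp: S_def D_def)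
  qed
  have \<phi>_props: "mono_on (gueb_dom \<tau>) \<phi>" "\<phi> 0 = 0" "\<And>t. t \<in> gueb_dom \<tau> \<Longrightarrow> 0 < t \<Longrightarrow> 0 < \<phi> t"
    and h_dom: "\<And>z. z \<in> S \<Longrightarrow> h z \<in> gueb_dom \<tau>" and \<phi>_h: "\<And>z. z \<in> S \<Longrightarrow> \<phi> (h z) \<le> g z"
    using \<phi> unfolding gueb_modulus_def INF_h by auto
  interpret gueb_rate \<tau> \<phi> t0
    by unfold_locales (use \<phi>_props t0 in \<open>auto simp: gueb_dom_def\<close>)
  have x0_S: "x0 \<in> S"
    by (simp add: S_iff' D_dist)
  have h0_dom: "h0 \<in> gueb_dom \<tau>"
    using h_dom[OF x0_S] by (simp add: h_def h0_def)
  have \<phi>_le: "\<phi> s \<le> s" if "0 < s" "s \<le> h0" for s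
  proof -
    \<comment> \<open>At this point of the segment from \<open>p0\<close> to \<open>x0\<close> the
      function \<open>h\<close> has the value \<open>s\<close>, and the modulus and the residual
      bound give \<open>\<phi> s \<le> g z \<le> h z = s\<close>.\<close>
    define z where "z = p0 + (sqrt s / D) *\<^sub>R (x0 - p0)"
    have "sqrt s \<le> D"
      using that D_pos by (simp add: h0_D real_le_lsqrt)
    then have "z \<in> S"
      using that D_pos D_dist by (simp add: S_iff' z_def dist_norm)
    moreover have "infdist z F = sqrt s"
      unfolding z_def p0_def
      using that D_pos by (subst infdist_closest_point_segment[OF F_closed F_convex F_nonempty]) (auto simp: D_def)
    then have hz: "h z = s"
      using that by (simp add: h_def)
    moreover have "g z \<le> h z"
      unfolding g_def h_def using m residual_le_infdist[OF T_fqne F_Fix F_nonempty]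
      by (intro Max.boundedI) (auto intro!: power_mono)
    ultimately show ?thesis
      using \<phi>_h[of z] by simp
  qed
  \<comment> \<open>The sign of \<open>\<psi>0\<close> depends on the order of \<open>h0\<close> and
    \<open>t0\<close>. Every real \<open>v \<ge> \<psi>0\<close> is a value of \<Psi>, so the
    inverse is meaningful there.\<close>
  define \<psi>0 where "\<psi>0 = (LBINT s=ereal h0..ereal t0. 1 / \<phi> s)"
  have \<Psi>_h0: "\<Psi> h0 = ereal \<psi>0"
    using h0_pos by (simp add: \<Psi>_def \<psi>0_def)
  have \<Psi>inv_nonneg: "0 \<le> \<Psi>inv (ereal v)" if "\<psi>0 \<le> v" for v
    using gueb_Psi_inv(1)[OF h0_pos h0_dom \<phi>_le, of v] \<Psi>_h0 that
    by (simp add: \<Psi>_def \<Psi>inv_def gueb_dom_def)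
  have le_\<Psi>inv: "t \<le> \<Psi>inv (ereal v)"
    if "\<psi>0 \<le> v" "t \<in> gueb_dom \<tau>" "ereal v \<le> \<Psi> t" for t v
    unfolding \<Psi>inv_def
    by (rule le_gueb_Psi_inv[OF h0_pos h0_dom \<phi>_le]) (use that \<Psi>_h0 in \<open>simp_all add: \<Psi>_def\<close>)

  \<comment> \<open>Measurability of the iterates and of a worst index\<close>
  have T_borel: "T j \<in> borel_measurable borel" if "j \<in> ?I" for j
    by (rule borel_measurable_continuous_onI[OF T_cont[OF that]])
  \<comment> \<open>An index with the largest residual at \<open>z\<close>. As \<open>J\<close> is
    Borel, \<open>J (x k \<omega>)\<close> is determined before \<open>i k\<close> is drawn.\<close>
  obtain J where J_borel: "J \<in> borel \<rightarrow>\<^sub>M count_space ?I" and J_range: "\<And>z. J z \<in> ?I"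
    and J_Max: "\<And>z. (norm (T (J z) z - z))\<^sup>2 = g z"
  proof (rule Max_attained_selection[of m "\<lambda>j z. (norm (T j z - z))\<^sup>2" borel])
    show "(\<lambda>z. (norm (T j z - z))\<^sup>2) \<in> borel_measurable borel" if "j \<in> ?I" for j
      using T_borel[OF that] by measurable
  qed (use m in \<open>auto simp: g_def\<close>)
  have x_adapted: "x k \<in> borel_measurable (\<F> k)" for k
  proof (induction k)
    case 0
    have "(\<lambda>_. x0) \<in> borel_measurable (\<F> 0)"
      by simp
    then show ?case
      by (rule measurable_cong[THEN iffD1, rotated])
        (simp add: x_0 filtration.space_F[OF filtration])
  next
    case (Suc k)
    have x_k[measurable]: "x k \<in> borel_measurable (\<F> (Suc k))"
      using Suc filtration.sets_F_mono[OF filtration, of k "Suc k"] filtration.space_F[OF filtration]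
      by (intro measurable_mono[THEN subsetD, OF order_refl refl _ _ Suc]) auto
    \<comment> \<open>The index takes finitely many values, so measurability may be checked for each
      fixed index.\<close>
    have [measurable]: "(\<lambda>\<omega>. T (i k \<omega>) (x k \<omega>)) \<in> borel_measurable (\<F> (Suc k))"
      by (rule measurable_compose_countable'[OF _ i_meas]) (auto intro: measurable_compose[OF x_k T_borel])
    have "(\<lambda>\<omega>. x k \<omega> + \<beta> k *\<^sub>R (T (i k \<omega>) (x k \<omega>) - x k \<omega>)) \<in> borel_measurable (\<F> (Suc k))"
      by measurable
    then show ?case
      by (rule measurable_cong[THEN iffD1, rotated])
        (simp add: x_Suc filtration.space_F[OF filtration])
  qed
  have x_meas [measurable]: "x k \<in> borel_measurable M" for k
    by (rule measurable_from_subalg[OF subalgebra x_adapted])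
  have infdist_meas [measurable]: "(\<lambda>\<omega>. infdist (x k \<omega>) F) \<in> borel_measurable M" for k
    by (intro borel_measurable_continuous_on[OF _ x_meas] continuous_on_infdist continuous_on_id)
  have Y_meas [measurable]: "Y k \<in> borel_measurable M" for k
    unfolding Y_def h_def by measurable

  \<comment> \<open>Draws of a worst index as biased trials\<close>
  define E where "E k = {\<omega>\<in>space M. i k \<omega> = J (x k \<omega>)}" for k
  have J_adapted: "(\<lambda>\<omega>. J (x k \<omega>)) \<in> \<F> k \<rightarrow>\<^sub>M count_space ?I" for k
    by (rule measurable_compose[OF x_adapted J_borel])
  interpret trials: biased_trials M \<F> E \<rho> \<beta> \<beta>bar
  proof
    fix k
    have J_Suc: "(\<lambda>\<omega>. J (x k \<omega>)) \<in> \<F> (Suc k) \<rightarrow>\<^sub>M count_space ?I"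
      using J_adapted[of k] filtration.sets_F_mono[OF filtration, of k "Suc k"] filtration.space_F[OF filtration]
      by (intro measurable_mono[THEN subsetD, OF order_refl refl _ _ J_adapted[of k]]) auto
    \<comment> \<open>Splitting by the common value writes \<open>E k\<close> as a finite union of
      events of \<open>\<F> (Suc k)\<close>.\<close>
    have "E k = (\<Union>j\<in>?I. (i k -` {j} \<inter> space (\<F> (Suc k))) \<inter> ((\<lambda>\<omega>. J (x k \<omega>)) -` {j} \<inter> space (\<F> (Suc k))))"
      unfolding E_def filtration.space_F[OF filtration] using J_range by auto
    also have "\<dots> \<in> sets (\<F> (Suc k))"
      by (intro sets.finite_UN sets.Int measurable_sets[OF i_meas] measurable_sets[OF J_Suc]) auto
    finally show "E k \<in> sets (\<F> (Suc k))" .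
    show "\<rho> * expectation W \<le> expectation (\<lambda>\<omega>. W \<omega> * indicator (E k) \<omega>)"
      if "W \<in> borel_measurable (\<F> k)" "\<And>\<omega>. \<omega> \<in> space M \<Longrightarrow> 0 \<le> W \<omega>" "\<And>\<omega>. \<omega> \<in> space M \<Longrightarrow> W \<omega> \<le> 1" for W
      unfolding E_def
      by (rule expectation_selected_ge[OF subalgebra _ J_adapted measurable_from_subalg[OF subalgebra i_meas] i_prob that])
        auto
  qed (use filtration.space_F[OF filtration] filtration.sets_F_mono[OF filtration] subalgebra \<rho> \<beta>_pos \<beta>_le in auto)
  have A_eq: "trials.A = A"
    by (simp add: fun_eq_iff trials.A_def A_def)
  have A_lim: "filterlim A at_top sequentially"
    using \<beta>_sum by (simp add: A_def)

  \<comment> \<open>Comparison with the rate function along each path\<close>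
  have Y_dom: "Y k \<omega> \<in> gueb_dom \<tau>" if "\<omega> \<in> space M" for k \<omega>
    unfolding Y_def by (rule h_dom[OF in_S[OF that]])
  have Y_le_h0: "Y k \<omega> \<le> h0" if "\<omega> \<in> space M" for k \<omega>
    unfolding Y_def h_def h0_D by (intro power_mono infdist_S in_S that infdist_nonneg)
  have Y_nonneg: "0 \<le> Y k \<omega>" for k \<omega>
    unfolding Y_def by (rule h_nonneg)
  have \<Psi>_Y: "ereal (\<psi>0 + (2 - \<beta>bar) * trials.R n \<omega>) \<le> \<Psi> (Y n \<omega>)" if \<omega>: "\<omega> \<in> space M" for n \<omega>
  proof -
    \<comment> \<open>Only draws of a worst index are counted; at the other steps \<open>w k\<close>
      is \<open>0\<close> and monotonicity of \<open>Y\<close> suffices.\<close>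
    define w where "w k = (2 - \<beta>bar) * (\<beta> k * indicator (E k) \<omega>)" for k
    have "Y (Suc k) \<omega> \<le> Y k \<omega> - w k * \<phi> (Y k \<omega>)" for k
    proof (cases "\<omega> \<in> E k")
      case True
      then have "(norm (T (i k \<omega>) (x k \<omega>) - x k \<omega>))\<^sup>2 = g (x k \<omega>)"
        using J_Max by (simp add: E_def)
      then have "\<phi> (Y k \<omega>) \<le> (norm (T (i k \<omega>) (x k \<omega>) - x k \<omega>))\<^sup>2"
        using \<phi>_h[OF in_S[OF \<omega>]] by (simp add: Y_def)
      then have "\<beta> k * (2 - \<beta>bar) * \<phi> (Y k \<omega>) \<le> \<beta> k * (2 - \<beta>bar) * (norm (T (i k \<omega>) (x k \<omega>) - x k \<omega>))\<^sup>2"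
        using \<beta>_pos[of k] \<beta>bar by (intro mult_left_mono) auto
      moreover have "w k = \<beta> k * (2 - \<beta>bar)"
        using True by (simp add: w_def)
      ultimately show ?thesis
        using Y_step[OF \<omega>, of k] by simp
    next
      case False
      have "0 \<le> \<beta> k * (2 - \<beta>bar) * (norm (T (i k \<omega>) (x k \<omega>) - x k \<omega>))\<^sup>2"
        using \<beta>_pos[of k] \<beta>bar by simp
      moreover have "w k = 0"
        using False by (simp add: w_def)
      ultimately show ?thesis
        using Y_step[OF \<omega>, of k] by simp
    qed
    moreover have "0 \<le> w k" for k
      using \<beta>_pos[of k] \<beta>bar by (simp add: w_def)
    ultimately have "gueb_Psi \<phi> t0 (Y 0 \<omega>) + ereal (\<Sum>k<n. w k) \<le> gueb_Psi \<phi> t0 (Y n \<omega>)"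
      by (intro gueb_Psi_iterate[of "\<lambda>k. Y k \<omega>" w n, OF \<phi>_props(2) Y_dom[OF \<omega>]])
    moreover have "Y 0 \<omega> = h0"
      by (simp add: Y_def h_def x_0[OF \<omega>] h0_def)
    moreover have "(\<Sum>k<n. w k) = (2 - \<beta>bar) * trials.R n \<omega>"
      unfolding w_def trials.R_def sum_distrib_left ..
    ultimately show ?thesis
      using \<Psi>_h0 by (simp add: \<Psi>_def)
  qed
  have Y_le: "Y n \<omega> \<le> \<Psi>inv (ereal v)"
    if "\<omega> \<in> space M" "\<psi>0 \<le> v" "v \<le> \<psi>0 + (2 - \<beta>bar) * trials.R n \<omega>" for n \<omega> v
  proof (rule le_\<Psi>inv[OF that(2) Y_dom[OF that(1)]])
    have "ereal v \<le> ereal (\<psi>0 + (2 - \<beta>bar) * trials.R n \<omega>)"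
      using that(3) by simp
    also note \<Psi>_Y[OF that(1)]
    finally show "ereal v \<le> \<Psi> (Y n \<omega>)" .
  qed
  have Y_int: "integrable M (Y k)" for k
    using Y_le_h0 Y_nonneg by (intro integrable_const_bound[where B = h0]) auto

  \<comment> \<open>The bound in expectation\<close>
  have expected_rate: "expectation (Y k) \<le> exp (- \<hh> * (\<rho> / \<beta>bar) * A k) * h0 + \<Psi>inv (\<Psi> h0 + ereal (c * A k))" for k
  proof -
    \<comment> \<open>On the event \<open>B\<close> of too little progress \<open>Y k\<close> is
      bounded by \<open>h0\<close>, and off it by the deterministic rate \<open>z\<close>.\<close>
    define B where "B = {\<omega>\<in>space M. trials.R k \<omega> < \<rho> * A k / 2}"
    define z where "z = \<Psi>inv (ereal (\<psi>0 + c * A k))"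
    have B_sets [measurable]: "B \<in> sets M"
      unfolding B_def by measurable
    have cA: "0 \<le> c * A k"
      using \<beta>bar \<rho> trials.A_nonneg[of k] by (simp add: c_def A_eq)
    then have z: "0 \<le> z"
      unfolding z_def by (intro \<Psi>inv_nonneg) simp
    have "expectation (Y k) \<le> expectation (\<lambda>\<omega>. h0 * indicator B \<omega> + z)"
    proof (rule integral_mono[OF Y_int])
      fix \<omega> assume \<omega>: "\<omega> \<in> space M"
      show "Y k \<omega> \<le> h0 * indicator B \<omega> + z"
      proof (cases "\<omega> \<in> B")
        case True
        then show ?thesis
          using Y_le_h0[OF \<omega>, of k] z by simp
      next
        case False
        then have "(2 - \<beta>bar) * (\<rho> * A k / 2) \<le> (2 - \<beta>bar) * trials.R k \<omega>"
          using \<omega> \<beta>bar by (intro mult_left_mono) (auto simp: B_def)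
        then have "Y k \<omega> \<le> z"
          unfolding z_def using cA by (intro Y_le[OF \<omega>]) (auto simp: c_def)
        then show ?thesis
          using False by simp
      qed
    qed (simp add: emeasure_eq_measure)
    also have "\<dots> = h0 * prob B + z"
      by (simp add: prob_space emeasure_eq_measure)
    also have "\<dots> \<le> h0 * exp (- \<hh> * (\<rho> / \<beta>bar) * A k) + z"
      using trials.prob_R_less_half[of k] h0_pos
      by (intro add_right_mono mult_left_mono) (auto simp: B_def A_eq \<hh>_def)
    finally show ?thesis
      by (simp add: z_def \<Psi>_h0 mult.commute)
  qed

  \<comment> \<open>The almost sure rate of the squared distance\<close>
  have pathwise_rate: "AE \<omega> in M. \<forall>\<^sub>F n in sequentially. Y n \<omega> \<le> \<Psi>inv (ereal (c * A n))"
    using trials.AE_eventually_R_ge[of "- \<psi>0 / (2 - \<beta>bar)", unfolded A_eq, OF A_lim] AE_space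
  proof eventually_elim
    case (elim \<omega>)
    have "0 < c"
      using \<beta>bar \<rho> by (simp add: c_def)
    \<comment> \<open>For small \<open>n\<close> the value \<open>c * A n\<close> may lie below
      \<open>\<psi>0\<close>, where \<open>Y_le\<close> does not apply; since \<open>A\<close>
      diverges it eventually passes \<open>\<psi>0\<close>.\<close>
    have "\<forall>\<^sub>F n in sequentially. \<psi>0 / c \<le> A n"
      using A_lim unfolding filterlim_at_top by blast
    with elim(1) show ?case
    proof eventually_elim
      case (elim n)
      have "\<psi>0 \<le> c * A n"
        using elim(2) \<open>0 < c\<close> by (simp add: pos_divide_le_eq mult.commute)
      \<comment> \<open>The constant passed to \<open>AE_eventually_R_ge\<close> is chosen to cancel
        the initial value \<open>\<psi>0\<close>, which is absent from the almost sure rate.\<close>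
      moreover have "(2 - \<beta>bar) * (\<rho> / 2 * A n + - \<psi>0 / (2 - \<beta>bar)) \<le> (2 - \<beta>bar) * trials.R n \<omega>"
        using elim(1) \<beta>bar by (intro mult_left_mono) auto
      moreover have "(2 - \<beta>bar) * (\<rho> / 2 * A n + - \<psi>0 / (2 - \<beta>bar)) = c * A n - \<psi>0"
        using \<beta>bar by (simp add: c_def right_diff_distrib)
      ultimately have "\<psi>0 \<le> c * A n" "c * A n \<le> \<psi>0 + (2 - \<beta>bar) * trials.R n \<omega>"
        by linarith+
      then show ?case
        by (rule Y_le[OF \<open>\<omega> \<in> space M\<close>])
    qed
  qed
  have rate_pred: "Measurable.pred M (\<lambda>\<omega>. Y n \<omega> \<le> \<Psi>inv (ereal (c * A n)))" for n
    by measurable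
  \<comment> \<open>The same index serves for both almost sure rates.\<close>
  obtain K :: "'w \<Rightarrow> enat" where K: "K \<in> M \<rightarrow>\<^sub>M count_space UNIV" "AE \<omega> in M. K \<omega> < \<infinity>"
    "\<And>\<omega> n. K \<omega> \<le> enat n \<Longrightarrow> Y n \<omega> \<le> \<Psi>inv (ereal (c * A n))"
    using rate_pred pathwise_rate by (rule AE_eventually_random_index) (rule that)

  \<comment> \<open>Almost sure convergence to a point of \<open>F\<close>\<close>
  define G where "G = {\<omega>\<in>space M. (\<lambda>n. infdist (x n \<omega>) F) \<longlonglongrightarrow> 0}"
  have G_sets [measurable]: "G \<in> sets M"
    unfolding G_def by measurable
  have AE_G: "AE \<omega> in M. \<omega> \<in> G"
    using trials.AE_eventually_R_ge[of 0, unfolded A_eq, OF A_lim] AE_space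
  proof eventually_elim
    case (elim \<omega>)
    have "(\<lambda>n. Y n \<omega>) \<longlonglongrightarrow> 0"
    proof (rule order_tendstoI)
      fix e :: real assume "0 < e"
      \<comment> \<open>Since \<open>s\<close> is positive, \<open>\<Psi> s\<close> is a finite
        level, which the growing lower bound on \<open>\<Psi> (Y n \<omega>)\<close> eventually
        passes. The cap \<open>h0\<close> keeps \<open>s\<close> in the domain.\<close>
      define s where "s = min (e / 2) h0"
      have s: "0 < s" "s < e" "s \<in> gueb_dom \<tau>"
        using \<open>0 < e\<close> h0_pos dom_downward[OF h0_dom, of s] by (auto simp: s_def)
      define v where "v = (LBINT r=ereal s..ereal t0. 1 / \<phi> r)"
      have "\<forall>\<^sub>F n in sequentially. (v - \<psi>0) / ((2 - \<beta>bar) * (\<rho> / 2)) \<le> A n"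
        using A_lim unfolding filterlim_at_top by blast
      with elim(1) show "\<forall>\<^sub>F n in sequentially. Y n \<omega> < e"
      proof eventually_elim
        case (elim n)
        have "v - \<psi>0 \<le> (2 - \<beta>bar) * (\<rho> / 2 * A n)"
          using elim(2) \<beta>bar \<rho> by (simp add: pos_divide_le_eq mult_ac)
        also have "\<dots> \<le> (2 - \<beta>bar) * trials.R n \<omega>"
          using elim(1) \<beta>bar by (intro mult_left_mono) auto
        finally have "ereal v \<le> ereal (\<psi>0 + (2 - \<beta>bar) * trials.R n \<omega>)"
          by simp
        also note \<Psi>_Y[OF \<open>\<omega> \<in> space M\<close>]
        finally have "gueb_Psi \<phi> t0 s \<le> gueb_Psi \<phi> t0 (Y n \<omega>)"
          using s(1) by (simp add: \<Psi>_def v_def)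
        then have "Y n \<omega> \<le> s"
          by (rule gueb_Psi_le_imp_ge[OF s(3) Y_dom[OF \<open>\<omega> \<in> space M\<close>]])
        then show ?case
          using s(2) by simp
      qed
    next
      fix e :: real assume "e < 0"
      then show "\<forall>\<^sub>F n in sequentially. e < Y n \<omega>"
        using less_le_trans[OF _ Y_nonneg] by (intro always_eventually) blast
    qed
    then have "(\<lambda>n. sqrt (Y n \<omega>)) \<longlonglongrightarrow> sqrt 0"
      by (rule tendsto_real_sqrt)
    then show ?case
      using elim(2) by (simp add: G_def Y_def sqrt_h)
  qed
  have lim_G: "lim (\<lambda>n. x n \<omega>) \<in> F" "(\<lambda>n. x n \<omega>) \<longlonglongrightarrow> lim (\<lambda>n. x n \<omega>)"
    "dist (x n \<omega>) (lim (\<lambda>n. x n \<omega>)) \<le> 2 * infdist (x n \<omega>) F" if "\<omega> \<in> G" for n \<omega>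
  proof -
    have "\<omega> \<in> space M" "(\<lambda>n. infdist (x n \<omega>) F) \<longlonglongrightarrow> 0"
      using that by (auto simp: G_def)
    then obtain l where l: "l \<in> F" "(\<lambda>n. x n \<omega>) \<longlonglongrightarrow> l" "\<And>n. dist (x n \<omega>) l \<le> 2 * infdist (x n \<omega>) F"
      using fejer_convergent[OF F_closed F_nonempty, of "\<lambda>n. x n \<omega>"] fejer by blast
    then have "lim (\<lambda>n. x n \<omega>) = l"
      by (intro limI)
    then show "lim (\<lambda>n. x n \<omega>) \<in> F" "(\<lambda>n. x n \<omega>) \<longlonglongrightarrow> lim (\<lambda>n. x n \<omega>)"
      "dist (x n \<omega>) (lim (\<lambda>n. x n \<omega>)) \<le> 2 * infdist (x n \<omega>) F"
      using l by auto
  qed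
  \<comment> \<open>The default \<open>p0\<close> keeps \<open>xstar\<close> in \<open>F\<close> and
    in \<open>S\<close> for every \<omega>, also outside the almost sure event
    \<open>G\<close>.\<close>
  define xstar where "xstar \<omega> = (if \<omega> \<in> G then lim (\<lambda>n. x n \<omega>) else p0)" for \<omega>
  have xstar_meas [measurable]: "xstar \<in> borel_measurable M"
    unfolding xstar_def by measurable
  have xstar_F: "xstar \<omega> \<in> F" for \<omega>
    using lim_G(1) p0 by (simp add: xstar_def)
  have AE_lim: "AE \<omega> in M. (\<lambda>n. x n \<omega>) \<longlonglongrightarrow> xstar \<omega>"
    using AE_G by eventually_elim (use lim_G(2) in \<open>simp add: xstar_def\<close>)
  have AE_dist: "AE \<omega> in M. \<forall>n. norm (x n \<omega> - xstar \<omega>) \<le> 2 * infdist (x n \<omega>) F"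
    using AE_G by eventually_elim (use lim_G(3) in \<open>simp add: xstar_def dist_norm\<close>)

  \<comment> \<open>Integrability, convergence in mean and the rate of the distance to the
    limit\<close>
  have norm_S: "norm z \<le> norm p0 + D" if "z \<in> S" for z
    using that norm_triangle_sub[of z p0] by (simp add: S_iff' dist_norm)
  have x_int: "integrable M (x k)" for k
    using norm_S[OF in_S] by (intro integrable_const_bound[where B = "norm p0 + D"]) auto
  have xstar_S: "xstar \<omega> \<in> S" for \<omega>
  proof (cases "\<omega> \<in> G")
    case True
    then have "\<omega> \<in> space M"
      by (simp add: G_def)
    then have "lim (\<lambda>n. x n \<omega>) \<in> S"
      using closed_sequentially[OF _ _ lim_G(2)[OF True], of S] in_S by (simp add: S_def)
    then show ?thesis
      using True by (simp add: xstar_def)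
  next
    case False
    then show ?thesis
      using D_pos by (simp add: xstar_def S_iff)
  qed
  have xstar_int: "integrable M xstar"
    using norm_S[OF xstar_S] by (intro integrable_const_bound[where B = "norm p0 + D"]) auto
  have infdist_int: "integrable M (\<lambda>\<omega>. infdist (x k \<omega>) F)" for k
    using infdist_S[OF in_S] by (intro integrable_const_bound[where B = D]) (auto simp: infdist_nonneg)
  have Y_eq: "Y k = (\<lambda>\<omega>. (infdist (x k \<omega>) F)\<^sup>2)" for k
    by (simp add: fun_eq_iff Y_def h_def)
  have L1_bound: "expectation (\<lambda>\<omega>. norm (x k \<omega> - xstar \<omega>)) \<le> 2 * sqrt (expectation (Y k))" for k
  proof -
    have "expectation (\<lambda>\<omega>. norm (x k \<omega> - xstar \<omega>)) \<le> expectation (\<lambda>\<omega>. 2 * infdist (x k \<omega>) F)"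
      using AE_dist x_int[of k] xstar_int infdist_int[of k] by (intro integral_mono_AE) auto
    also have "\<dots> = 2 * expectation (\<lambda>\<omega>. infdist (x k \<omega>) F)"
      by simp
    also have "\<dots> \<le> 2 * sqrt (expectation (Y k))"
      using expectation_le_sqrt_expectation_power2[OF infdist_int[of k]] Y_int[of k]
      by (simp add: Y_eq)
    finally show ?thesis .
  qed
  have L1_lim: "(\<lambda>k. expectation (\<lambda>\<omega>. norm (x k \<omega> - xstar \<omega>))) \<longlonglongrightarrow> 0"
  proof -
    have "(\<lambda>k. expectation (\<lambda>\<omega>. norm (x k \<omega> - xstar \<omega>))) \<longlonglongrightarrow> expectation (\<lambda>_. 0)"
    proof (rule integral_dominated_convergence[where w = "\<lambda>_. 2 * D"])
      show "AE \<omega> in M. (\<lambda>k. norm (x k \<omega> - xstar \<omega>)) \<longlonglongrightarrow> 0"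
        using AE_lim by eventually_elim (simp add: tendsto_norm_zero LIM_zero)
      show "AE \<omega> in M. norm (norm (x k \<omega> - xstar \<omega>)) \<le> 2 * D" for k
        using AE_dist AE_space
      proof eventually_elim
        case (elim \<omega>)
        have "norm (x k \<omega> - xstar \<omega>) \<le> 2 * infdist (x k \<omega>) F"
          using elim(1) by blast
        then show ?case
          using infdist_S[OF in_S[OF elim(2)], of k] by simp
      qed
    qed auto
    then show ?thesis
      by simp
  qed
  have AE_rate: "AE \<omega> in M. \<forall>k. K \<omega> \<le> enat k \<longrightarrow> norm (x k \<omega> - xstar \<omega>) \<le> 2 * sqrt (\<Psi>inv (ereal (c * A k)))"
    using AE_dist
  proof eventually_elim
    case (elim \<omega>)
    show ?case
    proof (intro allI impI)
      fix k assume "K \<omega> \<le> enat k"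
      then have "sqrt (Y k \<omega>) \<le> sqrt (\<Psi>inv (ereal (c * A k)))"
        using K(3) by simp
      then show "norm (x k \<omega> - xstar \<omega>) \<le> 2 * sqrt (\<Psi>inv (ereal (c * A k)))"
        using elim[rule_format, of k] by (simp add: Y_def sqrt_h)
    qed
  qed
  show ?thesis
  proof (intro conjI exI[of _ xstar] exI[of _ K] allI impI)
    show "AE \<omega> in M. \<forall>k. K \<omega> \<le> enat k \<longrightarrow>
        (infdist (x k \<omega>) F)\<^sup>2 \<le> \<Psi>inv (ereal ((2 - \<beta>bar) * \<rho> / 2 * A k))"
      using K(3) by (simp add: Y_eq c_def)
  qed (use Y_int expected_rate K(1,2) xstar_meas xstar_F AE_lim xstar_int x_int L1_lim L1_bound AE_rate
      in \<open>simp_all add: Y_eq c_def\<close>)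
qed

end
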